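(* Let $\{X,A,A(\cdot),\tilde q\}$ be a CTJMDP satisfying $\bar q(x)<\infty$ for all $x\in X$. Let $x\in X$ be an initial state and $\pi$ a policy. If a set $Z\in\mathfrak{B}(X)$ is $(x,\pi)$-bounded, that is, $$\sup_{t\in\mathbb{R}_+}\mathbb{E}_x^\pi\big[\tilde q(\xi_t,\pi_t)\,I\{\xi_t\in Z\}\big]<+\infty,$$ then for all $t\in\mathbb{R}_+$ $$P_x^\pi(t,Z)=\delta_x(Z)+\mathbb{E}_x^\pi\int_0^t\tilde q(\xi_s,\pi_s,Z\setminus\{\xi_s\})\,I\{\xi_s\in X\}\,ds-\mathbb{E}_x^\pi\int_0^t\tilde q(\xi_s,\pi_s)\,I\{\xi_s\in Z\}\,ds.$$
   Context: Notation: $\mathbb{R}_+=(0,+\infty)$, $\bar{\mathbb{R}}_+=(0,+\infty]$; $\mathfrak{B}(S)$ is the $\sigma$-algebra of a standard Borel space $S$, $\mathcal{P}(S)$ the set of probability measures on it, $I$ denotes indicators, $\delta_s$ the Dirac measure at $s$. Model. A continuous-time jump Markov decision process (CTJMDP) $\{X,A,A(\cdot),\tilde q\}$ consists of standard Borel spaces $X$ (states) and $A$ (actions); nonempty sets $A(x)\subseteq A$, $x\in X$, such that $Gr(A)=\{(x,a):x\in X,\ a\in A(x)\}$ is a measurable subset of $X\times A$ containing the graph of a measurable mapping $X\to A$; and, for $(x,a)\in Gr(A)$, a signed measure $\tilde q(x,a,\cdot)$ on $X$ with $\tilde q(x,a,X)=0$, $0\le\tilde q(x,a,Z\setminus\{x\})<\infty$,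 and $\tilde q(x,a,Z)$ measurable on $Gr(A)$ for each $Z\in\mathfrak{B}(X)$. Put $\tilde q(x,a)=\tilde q(x,a,X\setminus\{x\})$ and $\bar q(x)=\sup_{a\in A(x)}\tilde q(x,a)$. For $p\in\mathcal{P}(A)$ and a function $f$ on $Gr(A)$, $f(z,p)=\int_{A(z)}f(z,a)\,p(da)$ whenever defined; in particular this defines $\tilde q(z,p,Z)$ and $\tilde q(z,p)$. Sample space. Add isolated points $x_\infty\notin X$, $a_\infty\notin A$; $\bar X=X\cup\{x_\infty\}$, $\bar A=A\cup\{a_\infty\}$, $A(x_\infty)=\{a_\infty\}$. $\Omega$ is the set of sequences $(x_0,t_1,x_1,t_2,x_2,\ldots)\in X\times(\bar{\mathbb{R}}_+\times\bar X)^\infty$ such that, for $n\ge1$: if $t_n<\infty$ then $x_n\in X$ and $t_{n+1}>t_n$; if $t_n=+\infty$ then $x_n=x_\infty$ and $t_{n+1}=+\infty$. $\mathcal{F}$ is the Borel $\sigma$-algebra of $\Omega$. Put $t_0=0$, $t_\infty=\lim_n t_n$, $\xi_t=x_n$ for $t_n\le t<t_{n+1}$, $\xi_t=x_\infty$ for $t\ge t_\infty$, and $\mathcal{F}_t=\sigma(\xi_s:0\le s\le t)$. Policies. A policy $\pi$ assigns to $(\omega,t)\in\Omega\times\mathbb{R}_+$ a probability measure $\pi_t(\omega)=\pi(\cdot\mid\omega,t)$ such that $\pi(B\mid\omega,t)$ is a predictable process for each $B\in\mathfrak{B}(A)$, $\pi(A(\xi_{t-}(\omega))\mid\omega,t)=1$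 if $t<t_\infty(\omega)$, and $\pi(\cdot\mid\omega,t)=\delta_{a_\infty}$ if $t\ge t_\infty(\omega)$. Equivalently, for $t_n<t\le t_{n+1}$, $t<t_\infty$, $\pi(\cdot\mid\omega,t)=\pi^n(\cdot\mid x_0,t_1,x_1,\ldots,t_n,x_n,t-t_n)$ for transition probabilities $\pi^n$, $n\ge0$. Probability measures. For a policy $\pi$ and $x\in X$, $\mathbb{P}_x^\pi$ is the unique probability measure on $(\Omega,\mathcal{F})$ such that $x_0=x$ almost surely and the predictable random measure $\nu^\pi([0,t],Z)=\int_0^t\tilde q(\xi_s,\pi_s,Z\setminus\{\xi_s\})I\{\xi_s\in X\}\,ds$ is the compensator, with respect to $(\mathcal{F}_t)$, of the jump measure $\mu([0,t],Z)=\sum_{n\ge1}I\{t_n\le t,\ x_n\in Z\}$; $\mathbb{E}_x^\pi$ is its expectation. For $t\in\mathbb{R}_+$ and $Z\in\mathfrak{B}(\bar X)$, $P_x^\pi(t,Z)=\mathbb{P}_x^\pi(\xi_t\in Z)$. *)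

theory Defs
  imports "HOL-Probability.Probability"
begin

section \<open>Standard Borel spaces and signed measures\<close>

text \<open>Only \<^term>\<open>space M\<close> and \<^term>\<open>sets M\<close> are used of the spaces of states and actions.\<close>

definition standard_borel :: "'a measure \<Rightarrow> bool" where
  "standard_borel M \<longleftrightarrow>
     (\<exists>T. completely_metrizable_space T \<and> separable_space T \<and>
          topspace T = space M \<and> sets M = sigma_sets (topspace T) {U. openin T U})"

text \<open>The space \<open>M\<close> with one isolated point \<^term>\<open>None\<close> added.\<close>

definition option_space :: "'a measure \<Rightarrow> 'a option measure" where
  "option_space M =
     sigma (insert None (Some ` space M)) (insert {None} ((\<lambda>B. Some ` B) ` sets M))"

definition Rplus :: "real measure" where
  "Rplus = restrict_space borel {0<..}"

definition signed_measure_on :: "'a measure \<Rightarrow> ('a set \<Rightarrow> real) \<Rightarrow> bool" where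
  "signed_measure_on M m \<longleftrightarrow>
     m {} = 0 \<and>
     (\<forall>E. range E \<subseteq> sets M \<longrightarrow> disjoint_family E \<longrightarrow> (\<lambda>i::nat. m (E i)) sums m (\<Union>i. E i))"


section \<open>Continuous-time jump Markov decision processes\<close>

definition Gr :: "'x measure \<Rightarrow> ('x \<Rightarrow> 'a set) \<Rightarrow> ('x \<times> 'a) set" where
  "Gr X Act = {(x, a). x \<in> space X \<and> a \<in> Act x}"

text \<open>\<open>Act x\<close> is the set of actions available at \<open>x\<close>. The transition rates can be taken
  real-valued: \<open>q x a (space X) = 0\<close> and finiteness of \<open>q x a (space X - {x})\<close>
  force \<open>q x a {x}\<close>, and hence all values, to be finite.\<close>

locale ctjmdp =
  fixes X :: "'x measure" and A :: "'a measure"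
    and Act :: "'x \<Rightarrow> 'a set" and q :: "'x \<Rightarrow> 'a \<Rightarrow> 'x set \<Rightarrow> real"
  assumes standard_borel_X: "standard_borel X"
    and standard_borel_A: "standard_borel A"
    and Act_nonempty: "\<And>x. x \<in> space X \<Longrightarrow> Act x \<noteq> {}"
    and Act_subset: "\<And>x. x \<in> space X \<Longrightarrow> Act x \<subseteq> space A"
    and Gr_measurable: "Gr X Act \<in> sets (X \<Otimes>\<^sub>M A)"
    and selector: "\<exists>\<phi> \<in> X \<rightarrow>\<^sub>M A. \<forall>x \<in> space X. \<phi> x \<in> Act x"
    and q_signed: "\<And>x a. (x, a) \<in> Gr X Act \<Longrightarrow> signed_measure_on X (q x a)"
    and q_total: "\<And>x a. (x, a) \<in> Gr X Act \<Longrightarrow> q x a (space X) = 0"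
    and q_nonneg: "\<And>x a Z. (x, a) \<in> Gr X Act \<Longrightarrow> Z \<in> sets X \<Longrightarrow> 0 \<le> q x a (Z - {x})"
    and q_measurable: "\<And>Z. Z \<in> sets X \<Longrightarrow>
          (\<lambda>(x, a). q x a Z) \<in> borel_measurable (restrict_space (X \<Otimes>\<^sub>M A) (Gr X Act))"

definition exit_rate :: "'x measure \<Rightarrow> ('x \<Rightarrow> 'a \<Rightarrow> 'x set \<Rightarrow> real) \<Rightarrow> 'x \<Rightarrow> 'a \<Rightarrow> real" where
  "exit_rate X q x a = q x a (space X - {x})"

definition max_exit_rate ::
  "'x measure \<Rightarrow> ('x \<Rightarrow> 'a set) \<Rightarrow> ('x \<Rightarrow> 'a \<Rightarrow> 'x set \<Rightarrow> real) \<Rightarrow> 'x \<Rightarrow> ereal" where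
  "max_exit_rate X Act q x = (SUP a \<in> Act x. ereal (exit_rate X q x a))"

text \<open>\<open>f(z,p)\<close>, the integral of \<open>f(z,\<cdot>)\<close> over the actions available at \<open>z\<close>, for \<open>f\<close>
  nonnegative on the graph; \<open>p\<close> lives on the actions together with the cemetery action
  \<^term>\<open>None\<close>.\<close>

definition action_avg ::
  "('x \<Rightarrow> 'a set) \<Rightarrow> ('x \<Rightarrow> 'a \<Rightarrow> real) \<Rightarrow> 'x \<Rightarrow> 'a option measure \<Rightarrow> ennreal" where
  "action_avg Act f z p =
     (\<integral>\<^sup>+ b. (case b of None \<Rightarrow> 0 | Some a \<Rightarrow> ennreal (f z a) * indicator (Act z) a) \<partial>p)"


section \<open>Trajectories\<close>

text \<open>The trajectory \<open>(x\<^sub>0, t\<^sub>1, x\<^sub>1, t\<^sub>2, x\<^sub>2, \<dots>)\<close> is the pair of \<open>x\<^sub>0\<close> and the sequence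
  \<open>n \<mapsto> (t\<^sub>n\<^sub>+\<^sub>1, x\<^sub>n\<^sub>+\<^sub>1)\<close>; \<^term>\<open>None\<close> is the cemetery state.\<close>

type_synonym 'x traj = "'x \<times> (nat \<Rightarrow> ereal \<times> 'x option)"

fun jump_time :: "nat \<Rightarrow> 'x traj \<Rightarrow> ereal" where
  "jump_time 0 \<omega> = 0"
| "jump_time (Suc n) \<omega> = fst (snd \<omega> n)"

fun post_state :: "nat \<Rightarrow> 'x traj \<Rightarrow> 'x option" where
  "post_state 0 \<omega> = Some (fst \<omega>)"
| "post_state (Suc n) \<omega> = snd (snd \<omega> n)"

definition trajs :: "'x measure \<Rightarrow> 'x traj set" where
  "trajs X = {\<omega>. fst \<omega> \<in> space X \<and>
     (\<forall>n\<ge>1. 0 < jump_time n \<omega> \<and> post_state n \<omega> \<in> insert None (Some ` space X) \<and>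
        (jump_time n \<omega> < \<infinity> \<longrightarrow>
           post_state n \<omega> \<in> Some ` space X \<and> jump_time n \<omega> < jump_time (Suc n) \<omega>) \<and>
        (jump_time n \<omega> = \<infinity> \<longrightarrow> post_state n \<omega> = None \<and> jump_time (Suc n) \<omega> = \<infinity>))}"

definition traj_space :: "'x measure \<Rightarrow> 'x traj measure" where
  "traj_space X =
     restrict_space (X \<Otimes>\<^sub>M (\<Pi>\<^sub>M n\<in>UNIV. borel \<Otimes>\<^sub>M option_space X)) (trajs X)"

definition explosion_time :: "'x traj \<Rightarrow> ereal" where
  "explosion_time \<omega> = lim (\<lambda>n. jump_time n \<omega>)"

definition state :: "real \<Rightarrow> 'x traj \<Rightarrow> 'x option" where
  "state t \<omega> =
     (if ereal t < explosion_time \<omega>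
      then post_state (THE n. jump_time n \<omega> \<le> ereal t \<and> ereal t < jump_time (Suc n) \<omega>) \<omega>
      else None)"

text \<open>The left limit of the state at \<open>t\<close>, for \<open>0 < t < explosion_time \<omega>\<close>.\<close>

definition state_left :: "real \<Rightarrow> 'x traj \<Rightarrow> 'x option" where
  "state_left t \<omega> =
     post_state (THE n. jump_time n \<omega> < ereal t \<and> ereal t \<le> jump_time (Suc n) \<omega>) \<omega>"

definition nat_filtration :: "'x measure \<Rightarrow> real \<Rightarrow> 'x traj measure" where
  "nat_filtration X t =
     sigma (trajs X)
       (\<Union>s\<in>{0..t}. (\<lambda>B. state s -` B \<inter> trajs X) ` sets (option_space X))"

text \<open>Time runs through \<open>(0,\<infinity>)\<close> only, so no generators at time \<open>0\<close> are needed.\<close>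

definition predictable :: "'x measure \<Rightarrow> ('x traj \<times> real) measure" where
  "predictable X =
     sigma (trajs X \<times> {0<..})
       {B \<times> {s<..u} | B s u. 0 \<le> s \<and> B \<in> sets (nat_filtration X s)}"


section \<open>Policies\<close>

definition hist_space :: "'x measure \<Rightarrow> nat \<Rightarrow> ('x \<times> (nat \<Rightarrow> real \<times> 'x)) measure" where
  "hist_space X n = X \<Otimes>\<^sub>M (\<Pi>\<^sub>M i\<in>{..<n}. Rplus \<Otimes>\<^sub>M X)"

definition hist :: "nat \<Rightarrow> 'x traj \<Rightarrow> 'x \<times> (nat \<Rightarrow> real \<times> 'x)" where
  "hist n \<omega> =
     (fst \<omega>, \<lambda>i\<in>{..<n}. (real_of_ereal (jump_time (Suc i) \<omega>), the (post_state (Suc i) \<omega>)))"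

text \<open>Predictability of a policy is expressed by transition probabilities \<open>\<kappa> n\<close> from the
  history \<open>(x\<^sub>0, t\<^sub>1, x\<^sub>1, \<dots>, t\<^sub>n, x\<^sub>n)\<close> and the time elapsed since \<open>t\<^sub>n\<close> to the actions.
  Measurability with respect to \<^const>\<open>predictable\<close> could not be required literally:
  \<^const>\<open>trajs\<close> contains trajectories with \<open>x\<^sub>n\<^sub>+\<^sub>1 = x\<^sub>n\<close>, so \<^const>\<open>nat_filtration\<close> does not
  determine the jump times pointwise, and not even \<open>{(\<omega>, t). t < explosion_time \<omega>}\<close>, on
  which a policy does not choose \<^term>\<open>None\<close>, belongs to \<^const>\<open>predictable\<close>.
  Every process predictable for \<^const>\<open>nat_filtration\<close> has the form below.\<close>

definition policy ::
  "'x measure \<Rightarrow> 'a measure \<Rightarrow> ('x \<Rightarrow> 'a set) \<Rightarrow>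
   ('x traj \<Rightarrow> real \<Rightarrow> 'a option measure) \<Rightarrow> bool" where
  "policy X A Act \<pi> \<longleftrightarrow>
     (\<exists>\<kappa>. (\<forall>n. \<kappa> n \<in> hist_space X n \<Otimes>\<^sub>M Rplus \<rightarrow>\<^sub>M prob_algebra A) \<and>
        (\<forall>\<omega>\<in>trajs X. \<forall>t>0. \<forall>n.
           jump_time n \<omega> < ereal t \<longrightarrow> ereal t \<le> jump_time (Suc n) \<omega> \<longrightarrow>
           ereal t < explosion_time \<omega> \<longrightarrow>
           \<pi> \<omega> t = distr (\<kappa> n (hist n \<omega>, t - real_of_ereal (jump_time n \<omega>)))
                     (option_space A) Some)) \<and>
     (\<forall>\<omega>\<in>trajs X. \<forall>t>0. ereal t < explosion_time \<omega> \<longrightarrow>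
        emeasure (\<pi> \<omega> t) (Some ` Act (the (state_left t \<omega>))) = 1) \<and>
     (\<forall>\<omega>\<in>trajs X. \<forall>t>0. explosion_time \<omega> \<le> ereal t \<longrightarrow>
        \<pi> \<omega> t = return (option_space A) None)"

text \<open>\<open>f(\<xi>\<^sub>t, \<pi>\<^sub>t) I{\<xi>\<^sub>t \<in> X}\<close>\<close>

definition along ::
  "('x \<Rightarrow> 'a set) \<Rightarrow> ('x traj \<Rightarrow> real \<Rightarrow> 'a option measure) \<Rightarrow> ('x \<Rightarrow> 'a \<Rightarrow> real) \<Rightarrow>
   real \<Rightarrow> 'x traj \<Rightarrow> ennreal" where
  "along Act \<pi> f t \<omega> =
     (case state t \<omega> of None \<Rightarrow> 0 | Some z \<Rightarrow> action_avg Act f z (\<pi> \<omega> t))"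


section \<open>The law of the process under a policy\<close>

definition jump_measure :: "'x measure \<Rightarrow> 'x traj \<Rightarrow> (real \<times> 'x) measure" where
  "jump_measure X \<omega> =
     measure_of (space (Rplus \<Otimes>\<^sub>M X)) (sets (Rplus \<Otimes>\<^sub>M X))
       (\<lambda>C. \<Sum>n. if jump_time (Suc n) \<omega> < \<infinity>
                  then indicator C (real_of_ereal (jump_time (Suc n) \<omega>), the (post_state (Suc n) \<omega>))
                  else 0)"

text \<open>The random measure \<open>\<nu>(ds, dz) = q(\<xi>\<^sub>s, \<pi>\<^sub>s, dz - {\<xi>\<^sub>s}) I{\<xi>\<^sub>s \<in> X} ds\<close>. It is not enough to
  prescribe it on sets \<open>(0,t] \<times> Z\<close>, on which it can be infinite after an explosion.\<close>

definition rate_measure ::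
  "'x measure \<Rightarrow> ('x \<Rightarrow> 'a set) \<Rightarrow> ('x \<Rightarrow> 'a \<Rightarrow> 'x set \<Rightarrow> real) \<Rightarrow>
   ('x traj \<Rightarrow> real \<Rightarrow> 'a option measure) \<Rightarrow> 'x traj \<Rightarrow> (real \<times> 'x) measure" where
  "rate_measure X Act q \<pi> \<omega> =
     measure_of (space (Rplus \<Otimes>\<^sub>M X)) (sets (Rplus \<Otimes>\<^sub>M X))
       (\<lambda>C. \<integral>\<^sup>+ s \<in> {0<..}. along Act \<pi> (\<lambda>z a. q z a (Pair s -` C - {z})) s \<omega> \<partial>lborel)"

text \<open>The random measure \<open>\<nu>\<close> is the compensator (dual predictable projection) of \<open>\<mu>\<close> under
  \<open>P\<close>: both give the same expected integral to all nonnegative predictable \<open>H(\<omega>, s, z)\<close>.\<close>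

definition is_compensator ::
  "'x measure \<Rightarrow> 'x traj measure \<Rightarrow> ('x traj \<Rightarrow> (real \<times> 'x) measure) \<Rightarrow>
   ('x traj \<Rightarrow> (real \<times> 'x) measure) \<Rightarrow> bool" where
  "is_compensator X P \<mu> \<nu> \<longleftrightarrow>
     (\<forall>H \<in> (predictable X \<Otimes>\<^sub>M X) \<rightarrow>\<^sub>M (borel :: ennreal measure).
        (\<integral>\<^sup>+ \<omega>. (\<integral>\<^sup>+ (s, z). H ((\<omega>, s), z) \<partial>\<mu> \<omega>) \<partial>P) =
        (\<integral>\<^sup>+ \<omega>. (\<integral>\<^sup>+ (s, z). H ((\<omega>, s), z) \<partial>\<nu> \<omega>) \<partial>P))"

text \<open>\<open>P\<close> is the law of the process with initial state \<open>x\<close> under \<open>\<pi>\<close>; these properties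
  determine \<open>P\<close> uniquely.\<close>

definition is_law ::
  "'x measure \<Rightarrow> ('x \<Rightarrow> 'a set) \<Rightarrow> ('x \<Rightarrow> 'a \<Rightarrow> 'x set \<Rightarrow> real) \<Rightarrow>
   ('x traj \<Rightarrow> real \<Rightarrow> 'a option measure) \<Rightarrow> 'x \<Rightarrow> 'x traj measure \<Rightarrow> bool" where
  "is_law X Act q \<pi> x P \<longleftrightarrow>
     prob_space P \<and> sets P = sets (traj_space X) \<and>
     (AE \<omega> in P. fst \<omega> = x) \<and>
     is_compensator X P (jump_measure X) (rate_measure X Act q \<pi>)"

definition state_prob :: "'x traj measure \<Rightarrow> real \<Rightarrow> 'x option set \<Rightarrow> real" where
  "state_prob P t Z = measure P {\<omega> \<in> space P. state t \<omega> \<in> Z}"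

text \<open>\<open>(x, \<pi>)\<close>-boundedness of \<open>Z\<close>, with \<open>P\<close> the law for \<open>x\<close> and \<open>\<pi>\<close>.\<close>

definition bounded_set ::
  "'x measure \<Rightarrow> ('x \<Rightarrow> 'a set) \<Rightarrow> ('x \<Rightarrow> 'a \<Rightarrow> 'x set \<Rightarrow> real) \<Rightarrow>
   ('x traj \<Rightarrow> real \<Rightarrow> 'a option measure) \<Rightarrow> 'x traj measure \<Rightarrow> 'x set \<Rightarrow> bool" where
  "bounded_set X Act q \<pi> P Z \<longleftrightarrow>
     (SUP t \<in> {0<..}.
        \<integral>\<^sup>+ \<omega>. along Act \<pi> (exit_rate X q) t \<omega> * indicator (Some ` Z) (state t \<omega>) \<partial>P) < \<infinity>"

end

theory Submission
  imports Defs
begin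

text \<open>The idea is to count the jumps up to time \<open>t\<close>. A jump is an arrival if it ends in \<open>Z\<close>, and a
  departure if it starts in \<open>Z\<close>; a jump from \<open>Z\<close> to \<open>Z\<close> is both. For every trajectory,
  as an identity in \<open>[0,\<infinity>]\<close>, the number of arrivals plus \<open>I{x\<^sub>0 \<in> Z}\<close> is the number of departures
  plus \<open>I{\<xi>\<^sub>t \<in> Z}\<close> (lemma \<open>arrivals_departures_balance\<close>): both sides count the sojourns in \<open>Z\<close> that
  have begun by time \<open>t\<close>. After an explosion no sojourn is in progress, and all of them have ended.

  The compensator property, applied to the indicators of \<open>{s \<le> t, z \<in> Z}\<close> and of
  \<open>{s \<le> t, \<xi>\<^sub>s\<^sub>- \<in> Z}\<close>, turns the expected numbers of arrivals and departures into the two integrals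
  of the theorem. The number of departures has finite expectation because \<open>Z\<close> is bounded (lemma
  \<open>expected_departures_finite\<close>), so it may be subtracted.

  Most of the work is to supply the measurability that this argument uses.
  The second indicator needs a version that is predictable for the natural filtration also after
  an explosion; it is built from the states at grid points (lemma \<open>left_limit_in_predictable\<close>).
  The compensator must be known to be a measure, and Tonelli's theorem requires rates that are
  measurable jointly in trajectory and time. Both follow from a jointly measurable version of the
  rates that is exact at all positive times except jump times (lemmas \<open>measurable_regular_rate\<close> and
  \<open>AE_regular_rate\<close>), which rests in turn on the joint measurability of
  \<open>q z a (B - {z})\<close> in \<open>z\<close> and \<open>a\<close> (lemma \<open>measurable_rate_kernel\<close>).\<close>

section \<open>Measurability of the transition rates\<close>

text \<open>The balls with centres in a countable dense set and radii \<open>1/(n+1)\<close> separate points.\<close>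

lemma countable_separating_family:
  assumes "standard_borel M"
  obtains U :: "nat \<Rightarrow> 'a set" where "\<And>i. U i \<in> sets M"
    and "\<And>x y. x \<in> space M \<Longrightarrow> y \<in> space M \<Longrightarrow> x \<noteq> y \<Longrightarrow> \<exists>i. y \<in> U i \<and> x \<notin> U i"
proof -
  obtain T where T: "completely_metrizable_space T" "separable_space T"
      "topspace T = space M" "sets M = sigma_sets (topspace T) {U. openin T U}"
    using assms unfolding standard_borel_def by blast
  have "metrizable_space T"
    using T(1) by (rule completely_metrizable_imp_metrizable_space)
  then obtain S d where Sd: "Metric_space S d" and Teq: "T = Metric_space.mtopology S d"
    unfolding metrizable_space_def by blast
  interpret Metric_space S d by (rule Sd)
  obtain C where C: "countable C" "C \<subseteq> S" "mtopology closure_of C = S"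
    using T(2) unfolding separable_space_def Teq by auto
  define \<B> where "\<B> = insert {} ((\<lambda>(c, n). mball c (1 / real (Suc n))) ` (C \<times> (UNIV :: nat set)))"
  have "countable \<B>" "\<B> \<noteq> {}" unfolding \<B>_def using C(1) by auto
  then have range_from: "range (from_nat_into \<B>) = \<B>"
    by (simp add: range_from_nat_into)
  have in_sets: "B \<in> sets M" if "B \<in> \<B>" for B
    using that unfolding \<B>_def T(4) Teq by (auto intro!: sigma_sets.Basic)
  have sep: "\<exists>B\<in>\<B>. y \<in> B \<and> x \<notin> B" if x: "x \<in> space M" and y: "y \<in> space M" and xy: "x \<noteq> y" for x y
  proof -
    have S: "x \<in> S" "y \<in> S" using x y T(3) Teq by auto
    then have "0 < d x y / 2" using xy by simp
    then obtain n where n: "inverse (real (Suc n)) < d x y / 2"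
      using reals_Archimedean by blast
    have "y \<in> mtopology closure_of C" using C(3) S by simp
    moreover have "0 < 1 / real (Suc n)" by simp
    ultimately obtain c where c: "c \<in> C" "c \<in> mball y (1 / real (Suc n))"
      unfolding metric_closure_of by blast
    have "d c y < d x y / 2" "1 / real (Suc n) < d x y / 2"
      using c n by (auto simp: inverse_eq_divide commute)
    moreover have "d x y \<le> d c x + d c y"
      using S c C(2) triangle[of x c y] commute by auto
    ultimately have "x \<notin> mball c (1 / real (Suc n))" by auto
    moreover have "y \<in> mball c (1 / real (Suc n))"
      using c by (simp add: commute)
    ultimately show ?thesis
      using c unfolding \<B>_def by blast
  qed
  show ?thesis
  proof (rule that[of "from_nat_into \<B>"])
    show "from_nat_into \<B> i \<in> sets M" for i
      using in_sets range_from by blast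
    show "\<exists>i. y \<in> from_nat_into \<B> i \<and> x \<notin> from_nat_into \<B> i"
      if "x \<in> space M" "y \<in> space M" "x \<noteq> y" for x y
      using sep[OF that] range_from by (metis rangeE)
  qed
qed

lemma standard_borel_singleton:
  assumes "standard_borel M" and "x \<in> space M"
  shows "{x} \<in> sets M"
proof -
  obtain U :: "nat \<Rightarrow> 'a set" where U: "\<And>i. U i \<in> sets M"
    and sep: "\<And>x y. x \<in> space M \<Longrightarrow> y \<in> space M \<Longrightarrow> x \<noteq> y \<Longrightarrow> \<exists>i. y \<in> U i \<and> x \<notin> U i"
    using countable_separating_family[OF assms(1)] by blast
  have "(\<Union>i\<in>{i. x \<notin> U i}. U i) \<in> sets M" using U by auto
  then have "space M - (\<Union>i\<in>{i. x \<notin> U i}. U i) \<in> sets M" by auto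
  moreover have "space M - (\<Union>i\<in>{i. x \<notin> U i}. U i) = {x}"
    using assms(2) sep sets.sets_into_space[OF U] by fastforce
  ultimately show ?thesis by simp
qed

text \<open>The jump rates \<open>B \<mapsto> q z a (B - {z})\<close> as a measure on the states; it is zero if \<open>a\<close> is not
  available at \<open>z\<close>.\<close>

definition rate_kernel ::
  "'x measure \<Rightarrow> ('x \<Rightarrow> 'a set) \<Rightarrow> ('x \<Rightarrow> 'a \<Rightarrow> 'x set \<Rightarrow> real) \<Rightarrow> 'x \<times> 'a \<Rightarrow> 'x measure" where
  "rate_kernel X Act q = (\<lambda>(z, a). measure_of (space X) (sets X)
     (\<lambda>B. ennreal (q z a (B - {z})) * indicator (Gr X Act) (z, a)))"

lemma space_rate_kernel [simp]: "space (rate_kernel X Act q p) = space X"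
  by (simp add: rate_kernel_def case_prod_beta)

lemma sets_rate_kernel [simp, measurable_cong]: "sets (rate_kernel X Act q p) = sets X"
  by (simp add: rate_kernel_def case_prod_beta)

context ctjmdp
begin

lemma Gr_iff: "(z, a) \<in> Gr X Act \<longleftrightarrow> z \<in> space X \<and> a \<in> Act z"
  by (simp add: Gr_def)

lemma emeasure_rate_kernel:
  assumes B: "B \<in> sets X"
  shows "emeasure (rate_kernel X Act q (z, a)) B = ennreal (q z a (B - {z})) * indicator (Gr X Act) (z, a)"
proof -
  let ?\<mu> = "\<lambda>B. ennreal (q z a (B - {z})) * indicator (Gr X Act) (z, a)"
  have "countably_additive (sets X) ?\<mu>"
  proof (cases "(z, a) \<in> Gr X Act")
    case True
    then have z: "{z} \<in> sets X"
      by (auto simp: Gr_iff standard_borel_X intro: standard_borel_singleton)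
    show ?thesis
    proof (rule countably_additiveI)
      fix E :: "nat \<Rightarrow> 'x set"
      assume E: "range E \<subseteq> sets X" "disjoint_family E" "(\<Union>i. E i) \<in> sets X"
      have "(\<lambda>i. q z a (E i - {z})) sums q z a (\<Union>i. E i - {z})"
      proof -
        have "range (\<lambda>i. E i - {z}) \<subseteq> sets X" using E(1) z by blast
        moreover have "disjoint_family (\<lambda>i. E i - {z})"
          using E(2) unfolding disjoint_family_on_def by blast
        ultimately show ?thesis
          using q_signed[OF True] unfolding signed_measure_on_def by blast
      qed
      moreover have "(\<Union>i. E i - {z}) = (\<Union>i. E i) - {z}" by blast
      moreover have "0 \<le> q z a (E i - {z})" for i
        using q_nonneg[OF True] E(1) by blast
      ultimately have "(\<Sum>i. ennreal (q z a (E i - {z}))) = ennreal (q z a ((\<Union>i. E i) - {z}))"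
        by (metis suminf_ennreal_eq)
      then show "(\<Sum>i. ?\<mu> (E i)) = ?\<mu> (\<Union>i. E i)"
        using True by simp
    qed
  next
    case False
    then show ?thesis by (simp add: countably_additive_def)
  qed
  moreover have "positive (sets X) ?\<mu>"
  proof (cases "(z, a) \<in> Gr X Act")
    case True
    then show ?thesis
      using q_signed[OF True] by (auto simp: positive_def signed_measure_on_def)
  qed (simp add: positive_def)
  ultimately show ?thesis
    unfolding rate_kernel_def
    by (simp add: emeasure_measure_of_sigma sets.sigma_algebra_axioms B)
qed

lemma finite_rate_kernel: "emeasure (rate_kernel X Act q p) B < \<infinity>"
proof (cases "B \<in> sets X")
  case True
  then show ?thesis
    by (cases p) (simp add: emeasure_rate_kernel indicator_def)
qed (simp add: emeasure_notin_sets)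

lemma measurable_rate:
  assumes B: "B \<in> sets X"
  shows "(\<lambda>p. ennreal (q (fst p) (snd p) B) * indicator (Gr X Act) p) \<in> borel_measurable (X \<Otimes>\<^sub>M A)"
proof -
  have "(\<lambda>p. ennreal (case p of (x, a) \<Rightarrow> q x a B)) \<in> borel_measurable (restrict_space (X \<Otimes>\<^sub>M A) (Gr X Act))"
    using q_measurable[OF B] by measurable
  then show ?thesis
    using Gr_measurable
    by (subst (asm) borel_measurable_restrict_space_iff_ennreal)
       (auto simp: case_prod_beta sets.Int_space_eq2)
qed

text \<open>The set \<open>B - {z}\<close> in the rate \<open>q z a (B - {z})\<close> varies with \<open>z\<close>, whereas the rates are
  assumed measurable for a fixed set only. For a sequence \<open>U\<close> that separates points, the rate
  is the limit over \<open>n\<close> of the rates into the union of the \<open>B \<inter> U i\<close> with \<open>i < n\<close> and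
  \<open>z \<notin> U i\<close>, and for each \<open>n\<close> only finitely many unions occur.\<close>

lemma measurable_rate_kernel:
  assumes B: "B \<in> sets X"
  shows "(\<lambda>p. emeasure (rate_kernel X Act q p) B) \<in> borel_measurable (X \<Otimes>\<^sub>M A)"
proof -
  obtain U :: "nat \<Rightarrow> 'x set" where U[measurable]: "\<And>i. U i \<in> sets X"
    and sep: "\<And>x y. x \<in> space X \<Longrightarrow> y \<in> space X \<Longrightarrow> x \<noteq> y \<Longrightarrow> \<exists>i. y \<in> U i \<and> x \<notin> U i"
    using countable_separating_family[OF standard_borel_X] by blast
  define V where "V J = B \<inter> (\<Union>i\<in>J. U i)" for J
  have V[measurable]: "V J \<in> sets X" for J unfolding V_def using B by measurable
  define I where "I n z = {i. i < n \<and> z \<notin> U i}" for n :: nat and z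
  have I_meas: "{p \<in> space (X \<Otimes>\<^sub>M A). I n (fst p) = J} \<in> sets (X \<Otimes>\<^sub>M A)" for n J
  proof -
    have "{p \<in> space (X \<Otimes>\<^sub>M A). I n (fst p) = J} =
      (if J \<subseteq> {..<n} then {p \<in> space (X \<Otimes>\<^sub>M A). \<forall>i\<in>{..<n}. (fst p \<notin> U i) = (i \<in> J)} else {})"
      unfolding I_def by (auto simp: space_pair_measure)
    also have "\<dots> \<in> sets (X \<Otimes>\<^sub>M A)" by (auto intro!: sets.sets_Collect_finite_All)
    finally show ?thesis .
  qed
  have "(\<lambda>p. emeasure (rate_kernel X Act q p) (V (I n (fst p)))) \<in> borel_measurable (X \<Otimes>\<^sub>M A)" for n
  proof -
    have "(\<lambda>p. \<Sum>J\<in>Pow {..<n}. indicator {p \<in> space (X \<Otimes>\<^sub>M A). I n (fst p) = J} p *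
        (ennreal (q (fst p) (snd p) (V J)) * indicator (Gr X Act) p)) \<in> borel_measurable (X \<Otimes>\<^sub>M A)"
      using I_meas measurable_rate[OF V]
      by (intro borel_measurable_sum borel_measurable_times_ennreal[OF borel_measurable_indicator])
    moreover have "(\<Sum>J\<in>Pow {..<n}. indicator {p \<in> space (X \<Otimes>\<^sub>M A). I n (fst p) = J} p *
        (ennreal (q (fst p) (snd p) (V J)) * indicator (Gr X Act) p)) =
        emeasure (rate_kernel X Act q p) (V (I n (fst p)))" if p: "p \<in> space (X \<Otimes>\<^sub>M A)" for p
    proof -
      have "I n (fst p) \<in> Pow {..<n}" by (auto simp: I_def)
      then have "(\<Sum>J\<in>Pow {..<n}. indicator {p \<in> space (X \<Otimes>\<^sub>M A). I n (fst p) = J} p *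
        (ennreal (q (fst p) (snd p) (V J)) * indicator (Gr X Act) p)) =
        ennreal (q (fst p) (snd p) (V (I n (fst p)))) * indicator (Gr X Act) p"
        using p by (subst sum.remove[of _ "I n (fst p)"]) (auto intro!: sum.neutral)
      also have "\<dots> = emeasure (rate_kernel X Act q (fst p, snd p)) (V (I n (fst p)))"
      proof -
        \<comment> \<open>The current state lies in none of the sets of the union.\<close>
        have "V (I n (fst p)) - {fst p} = V (I n (fst p))"
          unfolding V_def I_def by auto
        then show ?thesis
          using emeasure_rate_kernel[OF V, of "fst p" "snd p" "I n (fst p)"] by simp
      qed
      finally show ?thesis by simp
    qed
    ultimately show ?thesis by (simp cong: measurable_cong)
  qed
  moreover have "(\<lambda>n. emeasure (rate_kernel X Act q p) (V (I n (fst p)))) \<longlonglongrightarrow> emeasure (rate_kernel X Act q p) B"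
    if p: "p \<in> space (X \<Otimes>\<^sub>M A)" for p
  proof -
    obtain z a where p_eq: "p = (z, a)" by (cases p)
    with p have z: "z \<in> space X" by (simp add: space_pair_measure)
    have *: "(\<Union>n. V (I n z)) = B - {z}"
    proof
      show "(\<Union>n. V (I n z)) \<subseteq> B - {z}" unfolding V_def I_def by auto
      show "B - {z} \<subseteq> (\<Union>n. V (I n z))"
      proof
        fix y assume y: "y \<in> B - {z}"
        then have "y \<in> space X" using B sets.sets_into_space by blast
        then obtain i where "y \<in> U i" "z \<notin> U i" using sep[of z y] z y by auto
        then have "y \<in> V (I (Suc i) z)" using y unfolding V_def I_def by auto
        then show "y \<in> (\<Union>n. V (I n z))" by blast
      qed
    qed
    have "(\<lambda>n. emeasure (rate_kernel X Act q p) (V (I n z))) \<longlonglongrightarrow> emeasure (rate_kernel X Act q p) (\<Union>n. V (I n z))"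
    proof (rule Lim_emeasure_incseq)
      show "range (\<lambda>n. V (I n z)) \<subseteq> sets (rate_kernel X Act q p)"
        using V unfolding sets_rate_kernel by blast
      have "I m z \<subseteq> I n z" if "m \<le> n" for m n using that unfolding I_def by auto
      then show "incseq (\<lambda>n. V (I n z))" unfolding incseq_def V_def by blast
    qed
    moreover have z_sets: "{z} \<in> sets X"
      by (rule standard_borel_singleton[OF standard_borel_X z])
    have "emeasure (rate_kernel X Act q p) (B - {z}) = emeasure (rate_kernel X Act q p) B"
      unfolding p_eq emeasure_rate_kernel[OF B] emeasure_rate_kernel[OF sets.Diff[OF B z_sets]]
      by simp
    ultimately show ?thesis unfolding * by (simp add: p_eq)
  qed
  ultimately show ?thesis
    by (rule borel_measurable_LIMSEQ_order[rotated])
qed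

end

section \<open>Spaces with a cemetery point\<close>

lemma space_option_space: "space (option_space M) = insert None (Some ` space M)"
  unfolding option_space_def by (rule space_measure_of) (use sets.sets_into_space in blast)

lemma sets_option_space:
  "sets (option_space M) = sigma_sets (insert None (Some ` space M)) (insert {None} ((\<lambda>B. Some ` B) ` sets M))"
  unfolding option_space_def by (rule sets_measure_of) (use sets.sets_into_space in blast)

lemma Some_image_in_sets [measurable (raw)]: "B \<in> sets M \<Longrightarrow> Some ` B \<in> sets (option_space M)"
  unfolding sets_option_space by (rule sigma_sets.Basic) blast

lemma measurable_Some [measurable]: "Some \<in> M \<rightarrow>\<^sub>M option_space M"
  unfolding option_space_def
proof (rule measurable_measure_of)
  fix y assume "y \<in> insert {None} ((\<lambda>B. Some ` B) ` sets M)"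
  then show "Some -` y \<inter> space M \<in> sets M"
  proof
    assume "y \<in> (\<lambda>B. Some ` B) ` sets M"
    then obtain B where "y = Some ` B" "B \<in> sets M" by blast
    moreover have "Some -` Some ` B = B" by blast
    ultimately show ?thesis by simp
  next
    assume "y = {None}"
    then have "Some -` y \<inter> space M = {}" by blast
    then show ?thesis by simp
  qed
qed (use sets.sets_into_space in blast)+

text \<open>The cemetery is an isolated point, so any value may be assigned to it.\<close>

lemma measurable_case_option_space:
  assumes g: "g \<in> M \<rightarrow>\<^sub>M N" and c: "c \<in> space N"
  shows "case_option c g \<in> option_space M \<rightarrow>\<^sub>M N"
proof (rule measurableI)
  show "case_option c g y \<in> space N" if "y \<in> space (option_space M)" for y
    using that measurable_space[OF g] c by (auto simp: space_option_space)
  fix S assume S: "S \<in> sets N"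
  have "{None} \<in> sets (option_space M)"
    unfolding sets_option_space by (rule sigma_sets.Basic) blast
  moreover have "Some ` (g -` S \<inter> space M) \<in> sets (option_space M)"
    by (intro Some_image_in_sets measurable_sets[OF g S])
  ultimately have "Some ` (g -` S \<inter> space M) \<union> (if c \<in> S then {None} else {}) \<in> sets (option_space M)"
    by (simp add: sets.Un)
  also have "Some ` (g -` S \<inter> space M) \<union> (if c \<in> S then {None} else {}) =
      case_option c g -` S \<inter> space (option_space M)"
    by (auto simp: space_option_space split: option.splits)
  finally show "case_option c g -` S \<inter> space (option_space M) \<in> sets (option_space M)" .
qed

section \<open>Jump rates into sections of a set of times and states\<close>

lemma space_Rplus: "space Rplus = {0<..}"
  by (simp add: Rplus_def space_restrict_space)

lemma sets_Rplus_borel: "S \<in> sets Rplus \<Longrightarrow> S \<in> sets borel"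
  by (auto simp: Rplus_def sets_restrict_space)

context ctjmdp
begin

lemma measurable_rate_kernel_section:
  assumes "C \<in> sets (Rplus \<Otimes>\<^sub>M X)"
  shows "(\<lambda>y. emeasure (rate_kernel X Act q (snd y)) (Pair (fst y) -` C))
    \<in> borel_measurable ((borel :: real measure) \<Otimes>\<^sub>M (X \<Otimes>\<^sub>M A))" (is "?f C \<in> borel_measurable ?M")
proof -
  have C: "C \<in> sigma_sets (space Rplus \<times> space X) {S \<times> B | S B. S \<in> sets Rplus \<and> B \<in> sets X}"
    using assms by (simp add: sets_pair_measure)
  note [measurable] = measurable_rate_kernel
  show ?thesis
    using Int_stable_pair_measure_generator pair_measure_closed C
  proof (induction rule: sigma_sets_induct_disjoint)
    case (basic D)
    then obtain S B where D: "D = S \<times> B" "S \<in> sets Rplus" "B \<in> sets X" by blast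
    have [measurable]: "S \<in> sets borel" "B \<in> sets X" using D sets_Rplus_borel by auto
    have "?f D y = indicator S (fst y) * emeasure (rate_kernel X Act q (snd y)) B" for y
      unfolding D(1) by (simp add: indicator_def)
    then show ?case by simp
  next
    case empty
    then show ?case by simp
  next
    case (compl D)
    have D: "D \<in> sets (Rplus \<Otimes>\<^sub>M X)" using compl by (simp add: sets_pair_measure)
    have [measurable]: "{0<..} \<in> sets (borel :: real measure)" by simp
    have "?f (space Rplus \<times> space X - D) y =
        indicator {0<..} (fst y) * (emeasure (rate_kernel X Act q (snd y)) (space X) - ?f D y)" for y
    proof (cases "fst y > 0")
      case True
      have s: "Pair (fst y) -` D \<in> sets X" using D by (rule sets_Pair1)
      have "Pair (fst y) -` (space Rplus \<times> space X - D) = space X - Pair (fst y) -` D"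
        using True by (auto simp: space_Rplus)
      also have "emeasure (rate_kernel X Act q (snd y)) (space X - Pair (fst y) -` D) =
          emeasure (rate_kernel X Act q (snd y)) (space X) - ?f D y"
        using s finite_rate_kernel[of "snd y" "Pair (fst y) -` D"] sets.sets_into_space[OF s]
        by (intro emeasure_Diff) (auto simp: less_top)
      finally show ?thesis using True by simp
    next
      case False
      then have "Pair (fst y) -` (space Rplus \<times> space X - D) = {}" by (auto simp: space_Rplus)
      then show ?thesis using False by simp
    qed
    then show ?case using compl by simp
  next
    case (union D)
    have "?f (\<Union>i. D i) y = (\<Sum>i. ?f (D i) y)" for y
    proof -
      have "D i \<in> sets (Rplus \<Otimes>\<^sub>M X)" for i
        using union(2) unfolding sets_pair_measure by blast
      then have "range (\<lambda>i. Pair (fst y) -` D i) \<subseteq> sets (rate_kernel X Act q (snd y))"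
        using sets_Pair1 by fastforce
      moreover have "disjoint_family (\<lambda>i. Pair (fst y) -` D i)"
        using union(1) unfolding disjoint_family_on_def by blast
      ultimately show ?thesis
        by (simp add: suminf_emeasure vimage_Union)
    qed
    then show ?case using union by simp
  qed
qed

end

section \<open>Trajectories\<close>

lemma post_state_in_space:
  assumes "\<omega> \<in> trajs X" "jump_time n \<omega> < \<infinity>"
  obtains z where "z \<in> space X" "post_state n \<omega> = Some z"
  using assms by (cases n) (fastforce simp: trajs_def)+

lemma jump_time_less_Suc:
  assumes "\<omega> \<in> trajs X" "jump_time n \<omega> < \<infinity>"
  shows "jump_time n \<omega> < jump_time (Suc n) \<omega>"
proof (cases n)
  case 0
  have "0 < jump_time 1 \<omega>" using assms(1) unfolding trajs_def by blast
  then show ?thesis using 0 by simp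
next
  case (Suc m)
  then have "n \<ge> 1" by simp
  then show ?thesis using assms unfolding trajs_def by blast
qed

lemma incseq_jump_time:
  assumes "\<omega> \<in> trajs X"
  shows "incseq (\<lambda>n. jump_time n \<omega>)"
proof (rule incseq_SucI)
  fix n
  show "jump_time n \<omega> \<le> jump_time (Suc n) \<omega>"
  proof (cases "jump_time n \<omega> < \<infinity>")
    case True
    then show ?thesis using jump_time_less_Suc[OF assms] by (simp add: less_imp_le)
  next
    case False
    then have "n \<ge> 1" by (cases n) auto
    moreover have "jump_time n \<omega> = \<infinity>" using False by simp
    ultimately have "jump_time (Suc n) \<omega> = \<infinity>" using assms unfolding trajs_def by blast
    then show ?thesis by simp
  qed
qed

lemma jump_time_nonneg:
  assumes "\<omega> \<in> trajs X"
  shows "0 \<le> jump_time n \<omega>"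
  using incseqD[OF incseq_jump_time[OF assms], of 0 n] by simp

lemma jump_time_Suc_pos:
  assumes "\<omega> \<in> trajs X"
  shows "0 < jump_time (Suc n) \<omega>"
proof -
  have "Suc n \<ge> 1" by simp
  then show ?thesis using assms unfolding trajs_def by blast
qed

lemma explosion_time_eq_SUP:
  assumes "\<omega> \<in> trajs X"
  shows "explosion_time \<omega> = (SUP n. jump_time n \<omega>)"
  unfolding explosion_time_def
  by (rule limI, rule LIMSEQ_SUP, rule incseq_jump_time[OF assms])

lemma less_explosion_time:
  assumes "\<omega> \<in> trajs X" "s < jump_time n \<omega>"
  shows "s < explosion_time \<omega>"
  using assms(2) unfolding explosion_time_eq_SUP[OF assms(1)] less_SUP_iff by blast

lemma jump_interval_unique:
  assumes "\<omega> \<in> trajs X"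
    and "jump_time n \<omega> \<le> s" "s < jump_time (Suc n) \<omega>" "jump_time m \<omega> \<le> s" "s < jump_time (Suc m) \<omega>"
  shows "m = n"
proof -
  have "\<not> Suc k \<le> l" if "s < jump_time (Suc k) \<omega>" "jump_time l \<omega> \<le> s" for k l
    using that incseqD[OF incseq_jump_time[OF assms(1)], of "Suc k" l] by auto
  from this[of n m] this[of m n] show ?thesis using assms by auto
qed

lemma jump_interval_exists:
  assumes "\<omega> \<in> trajs X" "0 \<le> s" "s < explosion_time \<omega>"
  obtains n where "jump_time n \<omega> \<le> s" "s < jump_time (Suc n) \<omega>"
proof -
  have ex: "\<exists>n. s < jump_time n \<omega>"
    using assms unfolding explosion_time_eq_SUP[OF assms(1)] less_SUP_iff by blast
  define m where "m = (LEAST n. s < jump_time n \<omega>)"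
  have m: "s < jump_time m \<omega>" unfolding m_def by (rule LeastI_ex[OF ex])
  with assms(2) have "m \<noteq> 0" by (cases m) auto
  then obtain n where n: "m = Suc n" by (cases m) auto
  have "\<not> s < jump_time n \<omega>" using not_less_Least[of n "\<lambda>n. s < jump_time n \<omega>"] n m_def by simp
  then show ?thesis using that m n by (metis not_less)
qed

lemma state_eq_post_state:
  assumes "\<omega> \<in> trajs X" "jump_time n \<omega> \<le> ereal s" "ereal s < jump_time (Suc n) \<omega>"
  shows "state s \<omega> = post_state n \<omega>"
proof -
  have "(THE n. jump_time n \<omega> \<le> ereal s \<and> ereal s < jump_time (Suc n) \<omega>) = n"
    using assms jump_interval_unique[OF assms(1)] by blast
  then show ?thesis
    using less_explosion_time[OF assms(1,3)] unfolding state_def by simp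
qed

lemma state_eq_Some_iff:
  assumes "\<omega> \<in> trajs X" "0 \<le> s"
  shows "state s \<omega> = Some z \<longleftrightarrow>
    (\<exists>n. jump_time n \<omega> \<le> ereal s \<and> ereal s < jump_time (Suc n) \<omega> \<and> post_state n \<omega> = Some z)"
proof
  assume st: "state s \<omega> = Some z"
  then have "ereal s < explosion_time \<omega>" by (auto simp: state_def split: if_splits)
  then obtain n where "jump_time n \<omega> \<le> ereal s" "ereal s < jump_time (Suc n) \<omega>"
    using jump_interval_exists[OF assms(1)] assms(2) by (metis ereal_less_eq(5))
  then show "\<exists>n. jump_time n \<omega> \<le> ereal s \<and> ereal s < jump_time (Suc n) \<omega> \<and> post_state n \<omega> = Some z"
    using state_eq_post_state[OF assms(1)] st by metis
next
  assume "\<exists>n. jump_time n \<omega> \<le> ereal s \<and> ereal s < jump_time (Suc n) \<omega> \<and> post_state n \<omega> = Some z"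
  then show "state s \<omega> = Some z" using state_eq_post_state[OF assms(1)] by metis
qed

lemma space_traj_space: "space (traj_space X) = trajs X"
proof -
  have "trajs X \<subseteq> space (X \<Otimes>\<^sub>M (\<Pi>\<^sub>M n\<in>UNIV. borel \<Otimes>\<^sub>M option_space X))"
  proof
    fix \<omega> :: "'a traj" assume \<omega>: "\<omega> \<in> trajs X"
    have "snd (snd \<omega> n) \<in> space (option_space X)" for n
    proof -
      have "Suc n \<ge> 1" by simp
      then have "post_state (Suc n) \<omega> \<in> insert None (Some ` space X)"
        using \<omega> unfolding trajs_def by blast
      then show ?thesis by (simp add: space_option_space)
    qed
    moreover have "fst \<omega> \<in> space X" using \<omega> by (simp add: trajs_def)
    ultimately show "\<omega> \<in> space (X \<Otimes>\<^sub>M (\<Pi>\<^sub>M n\<in>UNIV. borel \<Otimes>\<^sub>M option_space X))"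
      by (cases \<omega>) (auto simp: space_pair_measure space_PiM mem_Times_iff PiE_iff)
  qed
  then show ?thesis unfolding traj_space_def space_restrict_space by blast
qed

lemma measurable_jump_time [measurable]: "jump_time n \<in> borel_measurable (traj_space X)"
proof (cases n)
  case (Suc m)
  have "(\<lambda>\<omega>. fst (snd \<omega> m)) \<in> borel_measurable (X \<Otimes>\<^sub>M (\<Pi>\<^sub>M n\<in>UNIV. borel \<Otimes>\<^sub>M option_space X))"
    by measurable
  then show ?thesis
    unfolding traj_space_def Suc by (auto intro: measurable_restrict_space1 simp: fun_eq_iff cong: measurable_cong)
qed (simp cong: measurable_cong)

lemma measurable_fst_traj [measurable]: "fst \<in> traj_space X \<rightarrow>\<^sub>M X"
  unfolding traj_space_def by (intro measurable_restrict_space1) measurable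

lemma measurable_post_state [measurable]: "post_state n \<in> traj_space X \<rightarrow>\<^sub>M option_space X"
proof (cases n)
  case (Suc m)
  have "(\<lambda>\<omega>. snd (snd \<omega> m)) \<in> X \<Otimes>\<^sub>M (\<Pi>\<^sub>M n\<in>UNIV. borel \<Otimes>\<^sub>M option_space X) \<rightarrow>\<^sub>M option_space X"
    by measurable
  then show ?thesis
    unfolding traj_space_def Suc by (auto intro: measurable_restrict_space1 cong: measurable_cong)
next
  case 0
  have "(\<lambda>\<omega>. Some (fst \<omega>)) \<in> traj_space X \<rightarrow>\<^sub>M option_space X" by measurable
  then show ?thesis unfolding 0 by (simp cong: measurable_cong)
qed

section \<open>A jointly measurable version of the rates along a trajectory\<close>

text \<open>A positive finite time as a real number; the value \<open>1\<close> for other times is arbitrary in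
  \<open>(0,\<infinity>)\<close>.\<close>

definition pos_time :: "ereal \<Rightarrow> real" where
  "pos_time r = (if 0 < r \<and> r < \<infinity> then real_of_ereal r else 1)"

lemma measurable_pos_time [measurable]: "pos_time \<in> borel \<rightarrow>\<^sub>M Rplus"
  unfolding Rplus_def
proof (rule measurable_restrict_space2)
  show "pos_time \<in> space borel \<rightarrow> {0<..}"
  proof
    fix r :: ereal
    show "pos_time r \<in> {0<..}" by (cases r) (auto simp: pos_time_def)
  qed
  show "pos_time \<in> borel_measurable borel"
    unfolding pos_time_def by measurable
qed

text \<open>The history up to the \<open>n\<close>-th jump, completed by arbitrary values where the trajectory has
  fewer than \<open>n\<close> jumps. Unlike \<^const>\<open>hist\<close>, it always is a point of the space of histories,
  and it is measurable on all trajectories.\<close>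

definition total_hist :: "'x \<Rightarrow> nat \<Rightarrow> 'x traj \<Rightarrow> 'x \<times> (nat \<Rightarrow> real \<times> 'x)" where
  "total_hist x0 n \<omega> = (fst \<omega>,
     \<lambda>i\<in>{..<n}. (pos_time (jump_time (Suc i) \<omega>), case_option x0 (\<lambda>z. z) (post_state (Suc i) \<omega>)))"

lemma measurable_total_post_state:
  assumes "x0 \<in> space X"
  shows "(\<lambda>\<omega>. case_option x0 (\<lambda>z. z) (post_state n \<omega>)) \<in> traj_space X \<rightarrow>\<^sub>M X"
  using measurable_compose[OF measurable_post_state measurable_case_option_space[OF measurable_ident_sets[OF refl] assms]] .

lemma measurable_total_hist:
  assumes "x0 \<in> space X"
  shows "total_hist x0 n \<in> traj_space X \<rightarrow>\<^sub>M hist_space X n"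
  unfolding total_hist_def hist_space_def
  using assms by (intro measurable_Pair measurable_restrict measurable_compose[OF measurable_jump_time]
    measurable_fst_traj measurable_pos_time measurable_total_post_state)

lemma total_hist_eq:
  assumes \<omega>: "\<omega> \<in> trajs X" and fin: "jump_time n \<omega> < \<infinity>"
  shows "total_hist x0 n \<omega> = hist n \<omega>"
proof -
  have "pos_time (jump_time (Suc i) \<omega>) = real_of_ereal (jump_time (Suc i) \<omega>) \<and>
      case_option x0 (\<lambda>z. z) (post_state (Suc i) \<omega>) = the (post_state (Suc i) \<omega>)" if "i < n" for i
  proof -
    have "jump_time (Suc i) \<omega> \<le> jump_time n \<omega>"
      using incseqD[OF incseq_jump_time[OF \<omega>], of "Suc i" n] that by simp
    then have fin_i: "jump_time (Suc i) \<omega> < \<infinity>" using fin by (rule le_less_trans)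
    obtain z where "post_state (Suc i) \<omega> = Some z" using post_state_in_space[OF \<omega> fin_i] .
    then show ?thesis
      using jump_time_Suc_pos[OF \<omega>, of i] fin_i unfolding pos_time_def by simp
  qed
  then show ?thesis unfolding total_hist_def hist_def by (auto simp: restrict_def fun_eq_iff)
qed

lemma emeasure_jump_measure:
  assumes C: "C \<in> sets (Rplus \<Otimes>\<^sub>M X)"
  shows "emeasure (jump_measure X \<omega>) C =
    (\<Sum>n. if jump_time (Suc n) \<omega> < \<infinity>
       then indicator C (real_of_ereal (jump_time (Suc n) \<omega>), the (post_state (Suc n) \<omega>)) else 0)"
    (is "_ = ?\<mu> C")
proof -
  have "countably_additive (sets (Rplus \<Otimes>\<^sub>M X)) ?\<mu>"
  proof (rule countably_additiveI)
    fix E :: "nat \<Rightarrow> (real \<times> 'a) set"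
    assume disj: "disjoint_family E"
    define g where "g C n = (if jump_time (Suc n) \<omega> < \<infinity>
       then indicator C (real_of_ereal (jump_time (Suc n) \<omega>), the (post_state (Suc n) \<omega>)) else 0 :: ennreal)" for C n
    have "(\<Sum>i. ?\<mu> (E i)) = (\<Sum>i. \<integral>\<^sup>+n. g (E i) n \<partial>count_space UNIV)"
      by (simp add: g_def nn_integral_count_space_nat)
    also have "\<dots> = (\<integral>\<^sup>+n. (\<Sum>i. g (E i) n) \<partial>count_space UNIV)"
      by (rule nn_integral_suminf[symmetric]) simp
    also have "(\<lambda>n. \<Sum>i. g (E i) n) = g (\<Union>i. E i)"
      by (simp add: g_def fun_eq_iff suminf_indicator[OF disj])
    finally show "(\<Sum>i. ?\<mu> (E i)) = ?\<mu> (\<Union>i. E i)"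
      by (simp add: g_def nn_integral_count_space_nat)
  qed
  moreover have "positive (sets (Rplus \<Otimes>\<^sub>M X)) ?\<mu>"
    by (simp add: positive_def cong: if_cong)
  ultimately show ?thesis
    unfolding jump_measure_def
    by (intro emeasure_measure_of_sigma sets.sigma_algebra_axioms C)
qed

lemma sets_jump_measure [simp, measurable_cong]: "sets (jump_measure X \<omega>) = sets (Rplus \<Otimes>\<^sub>M X)"
  by (simp add: jump_measure_def)

lemma sets_rate_measure [simp, measurable_cong]: "sets (rate_measure X Act q \<pi> \<omega>) = sets (Rplus \<Otimes>\<^sub>M X)"
  by (simp add: rate_measure_def)

text \<open>A decision process with a policy given by transition probabilities \<open>\<kappa> n\<close>; the state \<open>x0\<close>
  replaces the cemetery where a state is required.\<close>

locale controlled_ctjmdp = ctjmdp X A Act q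
  for X :: "'x measure" and A :: "'a measure"
    and Act :: "'x \<Rightarrow> 'a set" and q :: "'x \<Rightarrow> 'a \<Rightarrow> 'x set \<Rightarrow> real" +
  fixes \<pi> :: "'x traj \<Rightarrow> real \<Rightarrow> 'a option measure"
    and \<kappa> :: "nat \<Rightarrow> ('x \<times> (nat \<Rightarrow> real \<times> 'x)) \<times> real \<Rightarrow> 'a measure"
    and x0 :: 'x
  assumes measurable_\<kappa>: "\<And>n. \<kappa> n \<in> hist_space X n \<Otimes>\<^sub>M Rplus \<rightarrow>\<^sub>M prob_algebra A"
    and \<pi>_eq: "\<And>\<omega> t n. \<omega> \<in> trajs X \<Longrightarrow> t > 0 \<Longrightarrow> jump_time n \<omega> < ereal t \<Longrightarrow>
      ereal t \<le> jump_time (Suc n) \<omega> \<Longrightarrow> ereal t < explosion_time \<omega> \<Longrightarrow>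
      \<pi> \<omega> t = distr (\<kappa> n (hist n \<omega>, t - real_of_ereal (jump_time n \<omega>))) (option_space A) Some"
    and x0: "x0 \<in> space X"
begin

text \<open>The distribution of the action at time \<open>s\<close> if \<open>s\<close> falls into the sojourn that begins with the
  \<open>n\<close>-th jump.\<close>

definition kernel_at :: "nat \<Rightarrow> 'x traj \<times> real \<Rightarrow> 'a measure" where
  "kernel_at n y = \<kappa> n (total_hist x0 n (fst y), pos_time (ereal (snd y) - jump_time n (fst y)))"

lemma measurable_kernel_at [measurable]:
  "kernel_at n \<in> traj_space X \<Otimes>\<^sub>M borel \<rightarrow>\<^sub>M subprob_algebra A"
proof -
  note [measurable] = measurable_total_hist[OF x0] measurable_prob_algebraD[OF measurable_\<kappa>]
  show ?thesis unfolding kernel_at_def by measurable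
qed

lemma sets_kernel_at:
  assumes "\<omega> \<in> trajs X"
  shows "sets (kernel_at n (\<omega>, s)) = sets A"
proof -
  have "(\<omega>, s) \<in> space (traj_space X \<Otimes>\<^sub>M borel)"
    using assms by (simp add: space_pair_measure space_traj_space)
  from measurable_space[OF measurable_kernel_at this] show ?thesis
    by (simp add: space_subprob_algebra)
qed

lemma kernel_at_eq:
  assumes \<omega>: "\<omega> \<in> trajs X" and s: "jump_time n \<omega> < ereal s"
  shows "kernel_at n (\<omega>, s) = \<kappa> n (hist n \<omega>, s - real_of_ereal (jump_time n \<omega>))"
proof -
  have fin: "jump_time n \<omega> < \<infinity>" using s by (rule less_trans) simp
  obtain r where r: "jump_time n \<omega> = ereal r"
    using fin jump_time_nonneg[OF \<omega>, of n] by (cases "jump_time n \<omega>") auto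
  have "pos_time (ereal s - jump_time n \<omega>) = s - real_of_ereal (jump_time n \<omega>)"
    using s unfolding r pos_time_def by simp
  then show ?thesis by (simp add: kernel_at_def total_hist_eq[OF \<omega> fin])
qed

lemma measurable_rate_kernel_action:
  assumes "z \<in> space X" "B \<in> sets X"
  shows "(\<lambda>a. emeasure (rate_kernel X Act q (z, a)) B) \<in> borel_measurable A"
  using measurable_compose[OF measurable_Pair1' measurable_rate_kernel] assms by simp

lemma along_eq_kernel_at:
  assumes \<omega>: "\<omega> \<in> trajs X" and s: "jump_time n \<omega> < ereal s" "ereal s < jump_time (Suc n) \<omega>"
    and z: "post_state n \<omega> = Some z" "z \<in> space X" and B: "B \<in> sets X"
  shows "along Act \<pi> (\<lambda>z a. q z a (B - {z})) s \<omega> =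
    (\<integral>\<^sup>+a. emeasure (rate_kernel X Act q (z, a)) B \<partial>kernel_at n (\<omega>, s))"
proof -
  have "ereal 0 < ereal s" using jump_time_nonneg[OF \<omega>, of n] s(1) unfolding zero_ereal_def by (rule le_less_trans)
  then have "0 < s" by simp
  then have \<pi>: "\<pi> \<omega> s = distr (kernel_at n (\<omega>, s)) (option_space A) Some"
    using \<pi>_eq[OF \<omega> _ s(1)] s less_explosion_time[OF \<omega> s(2)]
    by (simp add: kernel_at_eq[OF \<omega> s(1)] less_imp_le del: jump_time.simps)
  have st: "state s \<omega> = Some z"
    using state_eq_post_state[OF \<omega> less_imp_le[OF s(1)] s(2)] z(1) by simp
  have eq: "ennreal (q z a (B - {z})) * indicator (Act z) a = emeasure (rate_kernel X Act q (z, a)) B" for a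
    using emeasure_rate_kernel[OF B, of z a] z(2) by (simp add: indicator_def Gr_iff)
  have meas: "case_option 0 (\<lambda>a. emeasure (rate_kernel X Act q (z, a)) B) \<in> borel_measurable (option_space A)"
    using measurable_case_option_space[OF measurable_rate_kernel_action[OF z(2) B]] by simp
  have "along Act \<pi> (\<lambda>z a. q z a (B - {z})) s \<omega> =
      (\<integral>\<^sup>+b. (case b of None \<Rightarrow> 0 | Some a \<Rightarrow> emeasure (rate_kernel X Act q (z, a)) B) \<partial>\<pi> \<omega> s)"
    unfolding along_def st action_avg_def by (simp add: eq)
  also have "\<dots> = (\<integral>\<^sup>+a. emeasure (rate_kernel X Act q (z, a)) B \<partial>kernel_at n (\<omega>, s))"
    unfolding \<pi> using measurable_Some[of A] meas
    by (subst nn_integral_distr) (simp_all add: sets_kernel_at[OF \<omega>] cong: measurable_cong_sets)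
  finally show ?thesis .
qed

text \<open>The rate at time \<open>s\<close> of jumps that start in \<open>Z\<close> and whose time and target form a point of \<open>C\<close>,
  if \<open>s\<close> lies strictly inside the sojourn after the \<open>n\<close>-th jump, and zero otherwise.\<close>

definition rate_term :: "'x set \<Rightarrow> (real \<times> 'x) set \<Rightarrow> nat \<Rightarrow> 'x traj \<times> real \<Rightarrow> ennreal" where
  "rate_term Z C n y =
     (if jump_time n (fst y) < ereal (snd y) \<and> ereal (snd y) < jump_time (Suc n) (fst y)
      then indicator Z (case_option x0 (\<lambda>z. z) (post_state n (fst y))) *
        (\<integral>\<^sup>+a. emeasure (rate_kernel X Act q (case_option x0 (\<lambda>z. z) (post_state n (fst y)), a)) (Pair (snd y) -` C)
          \<partial>kernel_at n y)
      else 0)"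

text \<open>The sum over all sojourns is zero at jump times and after an explosion. It is jointly measurable
  in trajectory and time, and for each trajectory it agrees with the rate expressed by
  \<^const>\<open>along\<close> at all positive times but the jump times, which are countably many.\<close>

definition regular_rate :: "'x set \<Rightarrow> (real \<times> 'x) set \<Rightarrow> 'x traj \<times> real \<Rightarrow> ennreal" where
  "regular_rate Z C y = (\<Sum>n. rate_term Z C n y)"

lemma measurable_regular_rate:
  assumes C: "C \<in> sets (Rplus \<Otimes>\<^sub>M X)" and Z[measurable]: "Z \<in> sets X"
  shows "regular_rate Z C \<in> borel_measurable (traj_space X \<Otimes>\<^sub>M borel)"
proof -
  note [measurable] = measurable_total_post_state[OF x0]
  have "(\<lambda>y. \<integral>\<^sup>+a. emeasure (rate_kernel X Act q (case_option x0 (\<lambda>z. z) (post_state n (fst y)), a)) (Pair (snd y) -` C)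
      \<partial>kernel_at n y) \<in> borel_measurable (traj_space X \<Otimes>\<^sub>M borel)" for n
  proof (rule nn_integral_measurable_subprob_algebra2[OF _ measurable_kernel_at])
    have "(\<lambda>(y, a). (snd y, (case_option x0 (\<lambda>z. z) (post_state n (fst y)), a)))
        \<in> (traj_space X \<Otimes>\<^sub>M borel) \<Otimes>\<^sub>M A \<rightarrow>\<^sub>M (borel :: real measure) \<Otimes>\<^sub>M (X \<Otimes>\<^sub>M A)"
      by measurable
    from measurable_compose[OF this measurable_rate_kernel_section[OF C]]
    show "(\<lambda>(y, a). emeasure (rate_kernel X Act q (case_option x0 (\<lambda>z. z) (post_state n (fst y)), a)) (Pair (snd y) -` C))
        \<in> borel_measurable ((traj_space X \<Otimes>\<^sub>M borel) \<Otimes>\<^sub>M A)"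
      by (simp add: case_prod_beta)
  qed
  then have "rate_term Z C n \<in> borel_measurable (traj_space X \<Otimes>\<^sub>M borel)" for n
    unfolding rate_term_def by measurable
  then show ?thesis unfolding regular_rate_def by measurable
qed

lemma regular_rate_interval:
  assumes \<omega>: "\<omega> \<in> trajs X" and s: "jump_time n \<omega> < ereal s" "ereal s < jump_time (Suc n) \<omega>"
    and z: "post_state n \<omega> = Some z"
  shows "regular_rate Z C (\<omega>, s) = indicator Z z *
    (\<integral>\<^sup>+a. emeasure (rate_kernel X Act q (z, a)) (Pair s -` C) \<partial>kernel_at n (\<omega>, s))"
proof -
  have "rate_term Z C m (\<omega>, s) = 0" if "m \<noteq> n" for m
    using that jump_interval_unique[OF \<omega> less_imp_le[OF s(1)] s(2), of m]
    by (auto simp: rate_term_def less_imp_le)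
  then have "regular_rate Z C (\<omega>, s) = rate_term Z C n (\<omega>, s)"
    unfolding regular_rate_def by (subst suminf_finite[of "{n}"]) auto
  then show ?thesis using s z by (simp add: rate_term_def)
qed

lemma regular_rate_eq_0:
  assumes "\<And>n. jump_time n \<omega> < ereal s \<Longrightarrow> \<not> ereal s < jump_time (Suc n) \<omega>"
  shows "regular_rate Z C (\<omega>, s) = 0"
proof -
  have "rate_term Z C n (\<omega>, s) = 0" for n using assms[of n] by (auto simp: rate_term_def)
  then show ?thesis by (simp add: regular_rate_def)
qed

lemma regular_rate_eq_along:
  assumes \<omega>: "\<omega> \<in> trajs X" and s: "jump_time n \<omega> < ereal s" "ereal s < jump_time (Suc n) \<omega>"
    and C: "C \<in> sets (Rplus \<Otimes>\<^sub>M X)"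
  shows "regular_rate Z C (\<omega>, s) =
    along Act \<pi> (\<lambda>z a. q z a (Pair s -` C - {z})) s \<omega> * indicator (Some ` Z) (state s \<omega>)"
proof -
  have "jump_time n \<omega> < \<infinity>" using s(1) by (rule less_trans) simp
  then obtain z where z: "z \<in> space X" "post_state n \<omega> = Some z"
    using post_state_in_space[OF \<omega>] by blast
  have "state s \<omega> = Some z"
    using state_eq_post_state[OF \<omega> less_imp_le[OF s(1)] s(2)] z(2) by simp
  then have ind: "indicator (Some ` Z) (state s \<omega>) = (indicator Z z :: ennreal)"
    by (auto simp: indicator_def)
  show ?thesis
    unfolding regular_rate_interval[OF \<omega> s z(2)] ind
      along_eq_kernel_at[OF \<omega> s z(2,1) sets_Pair1[OF C]]
    by (rule mult.commute)
qed

text \<open>This holds at every time, so a bound on the expected rates at fixed times passes to the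
  measurable version.\<close>

lemma regular_rate_le_along:
  assumes \<omega>: "\<omega> \<in> trajs X" and C: "C \<in> sets (Rplus \<Otimes>\<^sub>M X)"
  shows "regular_rate Z C (\<omega>, s) \<le>
    along Act \<pi> (\<lambda>z a. q z a (Pair s -` C - {z})) s \<omega> * indicator (Some ` Z) (state s \<omega>)"
proof (cases "\<exists>n. jump_time n \<omega> < ereal s \<and> ereal s < jump_time (Suc n) \<omega>")
  case True
  then obtain n where "jump_time n \<omega> < ereal s" "ereal s < jump_time (Suc n) \<omega>" by blast
  from regular_rate_eq_along[OF \<omega> this C] show ?thesis by simp
next
  case False
  then show ?thesis using regular_rate_eq_0[of \<omega> s Z C] by simp
qed

lemma AE_interval_or_exploded:
  assumes \<omega>: "\<omega> \<in> trajs X"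
  shows "AE s in lborel. 0 < s \<longrightarrow>
    (\<exists>n. jump_time n \<omega> < ereal s \<and> ereal s < jump_time (Suc n) \<omega>) \<or> explosion_time \<omega> \<le> ereal s"
proof -
  have "AE s in lborel. s \<notin> range (\<lambda>n. real_of_ereal (jump_time n \<omega>))"
    by (intro AE_not_in countable_imp_null_set_lborel) simp
  then show ?thesis
  proof (rule AE_mp, intro AE_I2 impI)
    fix s :: real
    assume s: "s \<notin> range (\<lambda>n. real_of_ereal (jump_time n \<omega>))" "0 < s"
    show "(\<exists>n. jump_time n \<omega> < ereal s \<and> ereal s < jump_time (Suc n) \<omega>) \<or> explosion_time \<omega> \<le> ereal s"
    proof (cases "ereal s < explosion_time \<omega>")
      case True
      have "0 \<le> ereal s" using s(2) by simp
      then obtain n where n: "jump_time n \<omega> \<le> ereal s" "ereal s < jump_time (Suc n) \<omega>"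
        using jump_interval_exists[OF \<omega> _ True] by blast
      moreover have "jump_time n \<omega> \<noteq> ereal s" using s(1) by (metis rangeI real_of_ereal.simps(1))
      ultimately show ?thesis by (auto simp: less_le)
    qed (simp add: not_less)
  qed
qed

lemma state_exploded: "explosion_time \<omega> \<le> ereal s \<Longrightarrow> state s \<omega> = None"
  unfolding state_def using leD by auto

lemma AE_regular_rate:
  assumes \<omega>: "\<omega> \<in> trajs X" and C: "C \<in> sets (Rplus \<Otimes>\<^sub>M X)"
  shows "AE s in lborel. 0 < s \<longrightarrow> regular_rate Z C (\<omega>, s) =
    along Act \<pi> (\<lambda>z a. q z a (Pair s -` C - {z})) s \<omega> * indicator (Some ` Z) (state s \<omega>)"
  using AE_interval_or_exploded[OF \<omega>]
proof (rule AE_mp, intro AE_I2 impI)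
  fix s :: real
  assume "0 < s \<longrightarrow> (\<exists>n. jump_time n \<omega> < ereal s \<and> ereal s < jump_time (Suc n) \<omega>) \<or> explosion_time \<omega> \<le> ereal s"
    and "0 < s"
  then consider n where "jump_time n \<omega> < ereal s" "ereal s < jump_time (Suc n) \<omega>" | "explosion_time \<omega> \<le> ereal s"
    by blast
  then show "regular_rate Z C (\<omega>, s) =
    along Act \<pi> (\<lambda>z a. q z a (Pair s -` C - {z})) s \<omega> * indicator (Some ` Z) (state s \<omega>)"
  proof cases
    case 1
    then show ?thesis by (rule regular_rate_eq_along[OF \<omega> _ _ C])
  next
    case 2
    then have "regular_rate Z C (\<omega>, s) = 0"
      using less_explosion_time[OF \<omega>] by (intro regular_rate_eq_0) (metis not_less)
    then show ?thesis by (simp add: along_def state_exploded[OF 2])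
  qed
qed

text \<open>For \<open>Z = space X\<close> the indicator is superfluous, as \<^const>\<open>along\<close> vanishes at the cemetery.\<close>

lemma AE_regular_rate_space:
  assumes \<omega>: "\<omega> \<in> trajs X" and C: "C \<in> sets (Rplus \<Otimes>\<^sub>M X)"
  shows "AE s in lborel. 0 < s \<longrightarrow>
    regular_rate (space X) C (\<omega>, s) = along Act \<pi> (\<lambda>z a. q z a (Pair s -` C - {z})) s \<omega>"
  using AE_regular_rate[OF \<omega> C, of "space X"]
proof (rule AE_mp, intro AE_I2 impI)
  fix s :: real
  assume *: "0 < s \<longrightarrow> regular_rate (space X) C (\<omega>, s) =
    along Act \<pi> (\<lambda>z a. q z a (Pair s -` C - {z})) s \<omega> * indicator (Some ` space X) (state s \<omega>)"
    and s: "0 < s"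
  show "regular_rate (space X) C (\<omega>, s) = along Act \<pi> (\<lambda>z a. q z a (Pair s -` C - {z})) s \<omega>"
  proof (cases "state s \<omega>")
    case None
    then show ?thesis using * s by (simp add: along_def)
  next
    case (Some z)
    then obtain n where n: "jump_time n \<omega> \<le> ereal s" "post_state n \<omega> = Some z"
      using state_eq_Some_iff[OF \<omega>, of s z] s by auto
    have "jump_time n \<omega> < \<infinity>" using n(1) by (rule le_less_trans) simp
    then have "z \<in> space X" using post_state_in_space[OF \<omega>] n(2) by (metis option.inject)
    then show ?thesis using * s Some by simp
  qed
qed

lemma regular_rate_suminf:
  assumes \<omega>: "\<omega> \<in> trajs X" and C: "\<And>i. C i \<in> sets (Rplus \<Otimes>\<^sub>M X)" and disj: "disjoint_family C"
  shows "regular_rate Z (\<Union>i. C i) (\<omega>, s) = (\<Sum>i. regular_rate Z (C i) (\<omega>, s))"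
proof (cases "\<exists>n. jump_time n \<omega> < ereal s \<and> ereal s < jump_time (Suc n) \<omega>")
  case True
  then obtain n where n: "jump_time n \<omega> < ereal s" "ereal s < jump_time (Suc n) \<omega>" by blast
  have "jump_time n \<omega> < \<infinity>" using n(1) by (rule less_trans) simp
  then obtain z where z: "z \<in> space X" "post_state n \<omega> = Some z"
    using post_state_in_space[OF \<omega>] by blast
  have sec: "Pair s -` C i \<in> sets X" for i using C by (rule sets_Pair1)
  have "emeasure (rate_kernel X Act q (z, a)) (Pair s -` (\<Union>i. C i)) =
      (\<Sum>i. emeasure (rate_kernel X Act q (z, a)) (Pair s -` C i))" for a
  proof -
    have "disjoint_family (\<lambda>i. Pair s -` C i)"
      using disj unfolding disjoint_family_on_def by blast
    moreover have "range (\<lambda>i. Pair s -` C i) \<subseteq> sets (rate_kernel X Act q (z, a))"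
      using sec unfolding sets_rate_kernel by blast
    ultimately show ?thesis by (simp add: suminf_emeasure vimage_Union)
  qed
  moreover have "(\<lambda>a. emeasure (rate_kernel X Act q (z, a)) (Pair s -` C i))
      \<in> borel_measurable (kernel_at n (\<omega>, s))" for i
    using measurable_rate_kernel_action[OF z(1) sec]
    by (simp cong: measurable_cong_sets add: sets_kernel_at[OF \<omega>])
  ultimately show ?thesis
    unfolding regular_rate_interval[OF \<omega> n z(2)]
    by (simp add: nn_integral_suminf)
next
  case False
  then have "regular_rate Z D (\<omega>, s) = 0" for D by (intro regular_rate_eq_0) blast
  then show ?thesis by simp
qed

lemma measurable_regular_rate_time:
  assumes \<omega>: "\<omega> \<in> trajs X" and C: "C \<in> sets (Rplus \<Otimes>\<^sub>M X)" and Z: "Z \<in> sets X"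
  shows "(\<lambda>s. regular_rate Z C (\<omega>, s)) \<in> borel_measurable borel"
  using measurable_compose[OF measurable_Pair1' measurable_regular_rate[OF C Z]] \<omega>
  by (simp add: space_traj_space)

lemma nn_integral_along_eq:
  assumes \<omega>: "\<omega> \<in> trajs X" and C: "C \<in> sets (Rplus \<Otimes>\<^sub>M X)"
  shows "(\<integral>\<^sup>+ s \<in> {0<..}. along Act \<pi> (\<lambda>z a. q z a (Pair s -` C - {z})) s \<omega> \<partial>lborel) =
    (\<integral>\<^sup>+ s \<in> {0<..}. regular_rate (space X) C (\<omega>, s) \<partial>lborel)"
  by (rule nn_integral_cong_AE) (use AE_regular_rate_space[OF \<omega> C] in \<open>auto simp: indicator_def\<close>)

text \<open>Countable additivity comes from monotone convergence for the measurable version of the rates.\<close>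

lemma emeasure_rate_measure:
  assumes \<omega>: "\<omega> \<in> trajs X" and C: "C \<in> sets (Rplus \<Otimes>\<^sub>M X)"
  shows "emeasure (rate_measure X Act q \<pi> \<omega>) C =
    (\<integral>\<^sup>+ s \<in> {0<..}. along Act \<pi> (\<lambda>z a. q z a (Pair s -` C - {z})) s \<omega> \<partial>lborel)" (is "_ = ?\<nu> C")
proof -
  have "countably_additive (sets (Rplus \<Otimes>\<^sub>M X)) ?\<nu>"
  proof (rule countably_additiveI)
    fix E :: "nat \<Rightarrow> (real \<times> 'x) set"
    assume E: "range E \<subseteq> sets (Rplus \<Otimes>\<^sub>M X)" "disjoint_family E" "(\<Union>i. E i) \<in> sets (Rplus \<Otimes>\<^sub>M X)"
    then have Ei: "E i \<in> sets (Rplus \<Otimes>\<^sub>M X)" for i by blast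
    note [measurable] = measurable_regular_rate_time[OF \<omega> Ei sets.top]
    have "(\<Sum>i. ?\<nu> (E i)) = (\<Sum>i. \<integral>\<^sup>+ s \<in> {0<..}. regular_rate (space X) (E i) (\<omega>, s) \<partial>lborel)"
      by (simp only: nn_integral_along_eq[OF \<omega> Ei])
    also have "\<dots> = (\<integral>\<^sup>+ s. (\<Sum>i. regular_rate (space X) (E i) (\<omega>, s) * indicator {0<..} s) \<partial>lborel)"
      by (rule nn_integral_suminf[symmetric]) measurable
    also have "\<dots> = (\<integral>\<^sup>+ s \<in> {0<..}. regular_rate (space X) (\<Union>i. E i) (\<omega>, s) \<partial>lborel)"
      by (simp add: regular_rate_suminf[OF \<omega> Ei E(2)])
    also have "\<dots> = ?\<nu> (\<Union>i. E i)"
      by (rule nn_integral_along_eq[OF \<omega> E(3), symmetric])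
    finally show "(\<Sum>i. ?\<nu> (E i)) = ?\<nu> (\<Union>i. E i)" .
  qed
  moreover have "positive (sets (Rplus \<Otimes>\<^sub>M X)) ?\<nu>"
  proof -
    have "regular_rate (space X) {} y = 0" for y by (simp add: regular_rate_def rate_term_def cong: if_cong)
    then show ?thesis
      unfolding positive_def nn_integral_along_eq[OF \<omega> sets.empty_sets] by simp
  qed
  ultimately show ?thesis
    unfolding rate_measure_def
    by (intro emeasure_measure_of_sigma sets.sigma_algebra_axioms C)
qed

end

section \<open>A predictable version of the left limit\<close>

text \<open>The largest multiple of \<open>1/(m+1)\<close> strictly below \<open>s\<close>.\<close>

definition grid_point :: "nat \<Rightarrow> real \<Rightarrow> real" where
  "grid_point m s = (real_of_int \<lceil>real (Suc m) * s\<rceil> - 1) / real (Suc m)"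

lemma grid_point_less: "grid_point m s < s"
proof -
  have "real_of_int \<lceil>real (Suc m) * s\<rceil> - 1 < real (Suc m) * s" by linarith
  then show ?thesis unfolding grid_point_def by (simp add: divide_less_eq mult.commute)
qed

lemma grid_point_ge: "s - 1 / real (Suc m) \<le> grid_point m s"
proof -
  have "s - 1 / real (Suc m) = (real (Suc m) * s - 1) / real (Suc m)"
    by (simp add: diff_divide_distrib)
  also have "\<dots> \<le> grid_point m s"
    unfolding grid_point_def by (intro divide_right_mono) linarith+
  finally show ?thesis .
qed

lemma grid_point_eq:
  "real k / real (Suc m) < s \<Longrightarrow> s \<le> real (Suc k) / real (Suc m) \<Longrightarrow> grid_point m s = real k / real (Suc m)"
proof -
  assume "real k / real (Suc m) < s" "s \<le> real (Suc k) / real (Suc m)"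
  then have "real k < real (Suc m) * s" "real (Suc m) * s \<le> real k + 1"
    by (simp_all add: divide_less_eq le_divide_eq mult.commute)
  then have "\<lceil>real (Suc m) * s\<rceil> = int k + 1"
    by (intro ceiling_unique) simp_all
  then show ?thesis by (simp add: grid_point_def)
qed

lemma grid_interval_exists:
  assumes "0 < s"
  obtains k where "real k / real (Suc m) < s" "s \<le> real (Suc k) / real (Suc m)"
proof -
  define u where "u = real (Suc m) * s"
  have "0 < u" using assms by (simp add: u_def)
  define k where "k = nat (\<lceil>u\<rceil> - 1)"
  have "real k = real_of_int \<lceil>u\<rceil> - 1" using \<open>0 < u\<close> unfolding k_def by (simp add: of_nat_nat)
  then have "real k < u" "u \<le> real (Suc k)" by linarith+
  then show ?thesis
    by (intro that[of k]) (simp_all add: divide_less_eq le_divide_eq u_def mult.commute)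
qed

text \<open>The pairs \<open>(\<omega>, s)\<close> with \<open>0 < s \<le> t\<close> such that the state lies in \<open>Z\<close> at the grid points
  just below \<open>s\<close>, for all fine enough grids. Before an explosion this says that the left limit of
  the state at \<open>s\<close> lies in \<open>Z\<close>. The set is predictable on the whole space, since it is expressed
  by states at deterministic times; the jump times are not functions of the states, as the
  state may stay the same at a jump.\<close>

definition left_limit_in :: "'x measure \<Rightarrow> real \<Rightarrow> 'x set \<Rightarrow> ('x traj \<times> real) set" where
  "left_limit_in X t Z = {(\<omega>, s). \<omega> \<in> trajs X \<and> s \<in> {0<..t} \<and>
     (\<exists>N. \<forall>m\<ge>N. state (grid_point m s) \<omega> \<in> Some ` Z)}"

lemma space_nat_filtration: "space (nat_filtration X s) = trajs X"
  unfolding nat_filtration_def by (rule space_measure_of) blast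

lemma state_in_sets_nat_filtration:
  assumes "Z \<in> sets X" "0 \<le> s"
  shows "{\<omega> \<in> trajs X. state s \<omega> \<in> Some ` Z} \<in> sets (nat_filtration X s)"
proof -
  have "state s -` (Some ` Z) \<inter> trajs X \<in>
      (\<Union>s\<in>{0..s}. (\<lambda>B. state s -` B \<inter> trajs X) ` sets (option_space X))"
    using assms(2) by (intro UN_I[of s] imageI Some_image_in_sets assms(1)) simp
  moreover have "(\<Union>s\<in>{0..s}. (\<lambda>B. state s -` B \<inter> trajs X) ` sets (option_space X)) \<subseteq> Pow (trajs X)"
    by blast
  ultimately have "state s -` (Some ` Z) \<inter> trajs X \<in> sets (nat_filtration X s)"
    unfolding nat_filtration_def by simp
  moreover have "{\<omega> \<in> trajs X. state s \<omega> \<in> Some ` Z} = state s -` (Some ` Z) \<inter> trajs X"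
    by blast
  ultimately show ?thesis by simp
qed

lemma predictable_generator:
  "{B \<times> {s<..u} | B s u. 0 \<le> s \<and> B \<in> sets (nat_filtration X s)} \<subseteq> Pow (trajs X \<times> {0<..})"
proof -
  have "B \<subseteq> trajs X" if "B \<in> sets (nat_filtration X s)" for B s
    using sets.sets_into_space[OF that] by (simp add: space_nat_filtration)
  then show ?thesis by fastforce
qed

lemma space_predictable: "space (predictable X) = trajs X \<times> {0<..}"
  unfolding predictable_def by (rule space_measure_of[OF predictable_generator])

lemma predictable_rectangle:
  assumes "0 \<le> s" "B \<in> sets (nat_filtration X s)"
  shows "B \<times> {s<..u} \<in> sets (predictable X)"
  unfolding predictable_def sets_measure_of[OF predictable_generator]
  using assms by (intro sigma_sets.Basic) blast

lemma predictable_upto: "trajs X \<times> {0<..t} \<in> sets (predictable X)"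
  using sets.top[of "nat_filtration X 0"] by (intro predictable_rectangle) (simp_all add: space_nat_filtration)

lemma left_limit_in_predictable:
  assumes Z: "Z \<in> sets X"
  shows "left_limit_in X t Z \<in> sets (predictable X)"
proof -
  define E where "E m = (\<Union>k. {\<omega> \<in> trajs X. state (real k / real (Suc m)) \<omega> \<in> Some ` Z} \<times>
      {real k / real (Suc m) <.. real (Suc k) / real (Suc m)})" for m
  have E_sets: "E m \<in> sets (predictable X)" for m
    unfolding E_def
    by (intro sets.countable_UN image_subsetI predictable_rectangle state_in_sets_nat_filtration Z) simp_all
  have E_iff: "(\<omega>, s) \<in> E m \<longleftrightarrow> state (grid_point m s) \<omega> \<in> Some ` Z" if \<omega>: "\<omega> \<in> trajs X" and s: "0 < s" for \<omega> s m
  proof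
    assume "(\<omega>, s) \<in> E m"
    then obtain k where "state (real k / real (Suc m)) \<omega> \<in> Some ` Z"
      "real k / real (Suc m) < s" "s \<le> real (Suc k) / real (Suc m)" unfolding E_def by auto
    then show "state (grid_point m s) \<omega> \<in> Some ` Z" using grid_point_eq by metis
  next
    assume *: "state (grid_point m s) \<omega> \<in> Some ` Z"
    obtain k where k: "real k / real (Suc m) < s" "s \<le> real (Suc k) / real (Suc m)"
      using grid_interval_exists[OF s] .
    then have "state (real k / real (Suc m)) \<omega> \<in> Some ` Z" using * grid_point_eq by metis
    then show "(\<omega>, s) \<in> E m" unfolding E_def using k \<omega> by (intro UN_I[of k]) simp_all
  qed
  have "left_limit_in X t Z = (trajs X \<times> {0<..t}) \<inter> (\<Union>N. \<Inter>m\<in>{N..}. E m)"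
  proof (intro set_eqI)
    fix y :: "'a traj \<times> real"
    obtain \<omega> s where y: "y = (\<omega>, s)" by (cases y)
    show "y \<in> left_limit_in X t Z \<longleftrightarrow> y \<in> (trajs X \<times> {0<..t}) \<inter> (\<Union>N. \<Inter>m\<in>{N..}. E m)"
    proof (cases "\<omega> \<in> trajs X \<and> s \<in> {0<..t}")
      case True
      then show ?thesis using E_iff[of \<omega> s]
        unfolding y left_limit_in_def Int_iff UN_iff INT_iff Ball_def by simp
    next
      case False
      then show ?thesis unfolding y left_limit_in_def by blast
    qed
  qed
  also have "\<dots> \<in> sets (predictable X)"
  proof -
    have "(\<Inter>m\<in>{N..}. E m) \<in> sets (predictable X)" for N
    proof (rule sets.countable_INT)
      show "E ` {N..} \<subseteq> sets (predictable X)" using E_sets by blast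
    qed simp
    then have "(\<Union>N. \<Inter>m\<in>{N..}. E m) \<in> sets (predictable X)"
      by (intro sets.countable_UN image_subsetI)
    then show ?thesis by (rule sets.Int[OF predictable_upto])
  qed
  finally show ?thesis .
qed

lemma left_limit_in_iff:
  assumes \<omega>: "\<omega> \<in> trajs X" and s: "jump_time n \<omega> < ereal s" "ereal s \<le> jump_time (Suc n) \<omega>"
  shows "(\<omega>, s) \<in> left_limit_in X t Z \<longleftrightarrow> s \<le> t \<and> post_state n \<omega> \<in> Some ` Z"
proof -
  have fin: "jump_time n \<omega> < \<infinity>" using s(1) by (rule less_trans) simp
  obtain r where r: "jump_time n \<omega> = ereal r" "0 \<le> r"
    using fin jump_time_nonneg[OF \<omega>, of n] by (cases "jump_time n \<omega>") auto
  with s have rs: "r < s" by simp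
  then obtain N where N: "inverse (real (Suc N)) < s - r" using reals_Archimedean[of "s - r"] by auto
  have st: "state (grid_point m s) \<omega> = post_state n \<omega>" if "N \<le> m" for m
  proof (rule state_eq_post_state[OF \<omega>])
    have "1 / real (Suc m) \<le> inverse (real (Suc N))"
      using that by (simp add: field_simps)
    then have "r \<le> grid_point m s" using grid_point_ge[of s m] N by linarith
    then show "jump_time n \<omega> \<le> ereal (grid_point m s)" using r by simp
    show "ereal (grid_point m s) < jump_time (Suc n) \<omega>"
      by (rule less_le_trans[OF _ s(2)]) (simp add: grid_point_less)
  qed
  have "(\<exists>M. \<forall>m\<ge>M. state (grid_point m s) \<omega> \<in> Some ` Z) \<longleftrightarrow> post_state n \<omega> \<in> Some ` Z"
  proof
    assume "\<exists>M. \<forall>m\<ge>M. state (grid_point m s) \<omega> \<in> Some ` Z"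
    then obtain M where "\<forall>m\<ge>M. state (grid_point m s) \<omega> \<in> Some ` Z" by blast
    then have "state (grid_point (max M N) s) \<omega> \<in> Some ` Z" by simp
    then show "post_state n \<omega> \<in> Some ` Z" using st[of "max M N"] by simp
  next
    assume "post_state n \<omega> \<in> Some ` Z"
    then show "\<exists>M. \<forall>m\<ge>M. state (grid_point m s) \<omega> \<in> Some ` Z" using st by (intro exI[of _ N]) simp
  qed
  then show ?thesis using \<omega> rs r(2) unfolding left_limit_in_def by auto
qed

lemma section_predictable:
  assumes \<omega>: "\<omega> \<in> trajs X" and D: "D \<in> sets (predictable X)"
  shows "Pair \<omega> -` D \<in> sets Rplus"
proof -
  have "Pair \<omega> \<in> Rplus \<rightarrow>\<^sub>M predictable X"
    unfolding predictable_def
  proof (rule measurable_measure_of[OF predictable_generator])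
    show "Pair \<omega> \<in> space Rplus \<rightarrow> trajs X \<times> {0<..}" using \<omega> by (auto simp: space_Rplus)
    fix y :: "('a traj \<times> real) set"
    assume "y \<in> {B \<times> {s<..u} | B s u. 0 \<le> s \<and> B \<in> sets (nat_filtration X s)}"
    then obtain B s u where y: "y = B \<times> {s<..u}" "0 \<le> s" by blast
    have "Pair \<omega> -` y \<inter> space Rplus = (if \<omega> \<in> B then {s<..u} else {})"
      using y by (auto simp: space_Rplus)
    also have "\<dots> \<in> sets Rplus"
      using y(2) by (auto simp: Rplus_def sets_restrict_space_iff)
    finally show "Pair \<omega> -` y \<inter> space Rplus \<in> sets Rplus" .
  qed
  from measurable_sets[OF this D] have "Pair \<omega> -` D \<inter> space Rplus \<in> sets Rplus" .
  moreover have "Pair \<omega> -` D \<subseteq> space Rplus"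
    using sets.sets_into_space[OF D] by (auto simp: space_predictable space_Rplus)
  ultimately show ?thesis by (simp add: Int_absorb2)
qed

section \<open>Balance of arrivals and departures\<close>

text \<open>Each sojourn in \<open>Z\<close> that has begun by time \<open>t\<close> has ended by time \<open>t\<close>, or is in progress at
  \<open>t\<close>. The sojourns that have begun are the initial one and those started by an arrival; the
  ones that have ended correspond to the departures. The identity holds in \<open>[0,\<infinity>]\<close> for every
  trajectory: after an explosion no sojourn is in progress, and the state is the cemetery.\<close>

lemma arrivals_departures_balance:
  assumes \<omega>: "\<omega> \<in> trajs X" and t: "0 \<le> t"
  shows "(\<Sum>n. if jump_time (Suc n) \<omega> \<le> ereal t \<and> post_state (Suc n) \<omega> \<in> Some ` Z then 1 else 0) + indicator Z (fst \<omega>)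
    = (\<Sum>n. if jump_time (Suc n) \<omega> \<le> ereal t \<and> post_state n \<omega> \<in> Some ` Z then 1 else 0) +
      (indicator (Some ` Z) (state t \<omega>) :: ennreal)"
proof -
  define a where "a n = (if jump_time n \<omega> \<le> ereal t \<and> post_state n \<omega> \<in> Some ` Z then 1 else 0 :: ennreal)" for n
  define b where "b n = (if jump_time (Suc n) \<omega> \<le> ereal t \<and> post_state n \<omega> \<in> Some ` Z then 1 else 0 :: ennreal)" for n
  define c where "c n = (if jump_time n \<omega> \<le> ereal t \<and> ereal t < jump_time (Suc n) \<omega> \<and> post_state n \<omega> \<in> Some ` Z then 1 else 0 :: ennreal)" for n
  \<comment> \<open>\<open>a\<close>, \<open>b\<close>, \<open>c\<close> indicate the sojourns in \<open>Z\<close> begun, ended and in progress at time \<open>t\<close>.\<close>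
  have "a n = b n + c n" for n
    using incseqD[OF incseq_jump_time[OF \<omega>], of n "Suc n"] by (auto simp: a_def b_def c_def not_le simp del: jump_time.simps)
  then have "(\<Sum>n. a n) = (\<Sum>n. b n) + (\<Sum>n. c n)" by (simp add: suminf_add)
  moreover have "(\<Sum>n. a n) = (\<Sum>n. a (Suc n)) + a 0"
    using suminf_offset[of a 1] by (simp add: add.commute)
  moreover have "a 0 = indicator Z (fst \<omega>)" using t by (auto simp: a_def indicator_def)
  moreover have "(\<Sum>n. c n) = indicator (Some ` Z) (state t \<omega>)"
  proof (cases "state t \<omega> \<in> Some ` Z")
    case True
    then obtain z where z: "z \<in> Z" "state t \<omega> = Some z" by blast
    then obtain n where n: "jump_time n \<omega> \<le> ereal t" "ereal t < jump_time (Suc n) \<omega>" "post_state n \<omega> = Some z"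
      using state_eq_Some_iff[OF \<omega> t] by blast
    have "c m = 0" if "m \<noteq> n" for m
      using that jump_interval_unique[OF \<omega> n(1,2), of m] unfolding c_def by auto
    then have "(\<Sum>n. c n) = c n" by (subst suminf_finite[of "{n}"]) auto
    then show ?thesis using n z by (simp add: c_def del: jump_time.simps)
  next
    case False
    then have "c n = 0" for n using state_eq_post_state[OF \<omega>, of n t] unfolding c_def by auto
    then show ?thesis using False by simp
  qed
  ultimately show ?thesis unfolding a_def b_def by simp
qed

section \<open>Expected numbers of arrivals and departures\<close>

text \<open>The compensator property for the indicator of \<open>D \<times> B\<close> with \<open>D\<close> predictable.\<close>

lemma compensator_rectangle:
  assumes comp: "is_compensator X P \<mu> \<nu>" and space_P: "space P = trajs X"
    and \<mu>: "\<And>\<omega>. sets (\<mu> \<omega>) = sets (Rplus \<Otimes>\<^sub>M X)" and \<nu>: "\<And>\<omega>. sets (\<nu> \<omega>) = sets (Rplus \<Otimes>\<^sub>M X)"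
    and D: "D \<in> sets (predictable X)" and B: "B \<in> sets X"
  shows "(\<integral>\<^sup>+ \<omega>. emeasure (\<mu> \<omega>) (Pair \<omega> -` D \<times> B) \<partial>P) = (\<integral>\<^sup>+ \<omega>. emeasure (\<nu> \<omega>) (Pair \<omega> -` D \<times> B) \<partial>P)"
proof -
  define H :: "('a traj \<times> real) \<times> 'a \<Rightarrow> ennreal" where "H = indicator (D \<times> B)"
  have "D \<times> B \<in> sets (predictable X \<Otimes>\<^sub>M X)" using D B by (rule pair_measureI)
  then have H: "H \<in> borel_measurable (predictable X \<Otimes>\<^sub>M X)"
    unfolding H_def by (rule borel_measurable_indicator)
  have *: "(\<integral>\<^sup>+ (s, z). H ((\<omega>, s), z) \<partial>M) = emeasure M (Pair \<omega> -` D \<times> B)"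
    if "\<omega> \<in> trajs X" "sets M = sets (Rplus \<Otimes>\<^sub>M X)" for \<omega> and M :: "(real \<times> 'a) measure"
  proof -
    have "Pair \<omega> -` D \<times> B \<in> sets M"
      unfolding that(2) by (rule pair_measureI[OF section_predictable[OF that(1) D] B])
    moreover have "(\<lambda>(s, z). H ((\<omega>, s), z)) = indicator (Pair \<omega> -` D \<times> B)"
      by (auto simp: H_def indicator_def fun_eq_iff)
    ultimately show ?thesis by simp
  qed
  have "(\<integral>\<^sup>+ \<omega>. (\<integral>\<^sup>+ (s, z). H ((\<omega>, s), z) \<partial>\<mu> \<omega>) \<partial>P) = (\<integral>\<^sup>+ \<omega>. (\<integral>\<^sup>+ (s, z). H ((\<omega>, s), z) \<partial>\<nu> \<omega>) \<partial>P)"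
    using comp H unfolding is_compensator_def by blast
  moreover have "(\<integral>\<^sup>+ \<omega>. (\<integral>\<^sup>+ (s, z). H ((\<omega>, s), z) \<partial>\<mu> \<omega>) \<partial>P) = (\<integral>\<^sup>+ \<omega>. emeasure (\<mu> \<omega>) (Pair \<omega> -` D \<times> B) \<partial>P)"
    by (intro nn_integral_cong * \<mu>) (simp add: space_P)
  moreover have "(\<integral>\<^sup>+ \<omega>. (\<integral>\<^sup>+ (s, z). H ((\<omega>, s), z) \<partial>\<nu> \<omega>) \<partial>P) = (\<integral>\<^sup>+ \<omega>. emeasure (\<nu> \<omega>) (Pair \<omega> -` D \<times> B) \<partial>P)"
    by (intro nn_integral_cong * \<nu>) (simp add: space_P)
  ultimately show ?thesis by simp
qed

lemma jump_measure_arrivals: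
  assumes \<omega>: "\<omega> \<in> trajs X" and Z: "Z \<in> sets X"
  shows "emeasure (jump_measure X \<omega>) (Pair \<omega> -` (trajs X \<times> {0<..t}) \<times> Z) =
    (\<Sum>n. if jump_time (Suc n) \<omega> \<le> ereal t \<and> post_state (Suc n) \<omega> \<in> Some ` Z then 1 else 0)"
proof -
  have C: "Pair \<omega> -` (trajs X \<times> {0<..t}) \<times> Z \<in> sets (Rplus \<Otimes>\<^sub>M X)"
    by (rule pair_measureI[OF section_predictable[OF \<omega> predictable_upto] Z])
  show ?thesis
    unfolding emeasure_jump_measure[OF C]
  proof (intro suminf_cong)
    fix n
    show "(if jump_time (Suc n) \<omega> < \<infinity> then indicator (Pair \<omega> -` (trajs X \<times> {0<..t}) \<times> Z)
        (real_of_ereal (jump_time (Suc n) \<omega>), the (post_state (Suc n) \<omega>)) else 0) =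
      (if jump_time (Suc n) \<omega> \<le> ereal t \<and> post_state (Suc n) \<omega> \<in> Some ` Z then 1 else 0 :: ennreal)"
    proof (cases "jump_time (Suc n) \<omega> < \<infinity>")
      case True
      obtain r where r: "jump_time (Suc n) \<omega> = ereal r" "0 < r"
        using True jump_time_Suc_pos[OF \<omega>, of n] by (cases "jump_time (Suc n) \<omega>") auto
      obtain z where "post_state (Suc n) \<omega> = Some z" using post_state_in_space[OF \<omega> True] .
      then show ?thesis using r \<omega> by (auto simp: indicator_def simp del: jump_time.simps post_state.simps)
    next
      case False
      then have "jump_time (Suc n) \<omega> = \<infinity>" by simp
      then show ?thesis by (simp del: jump_time.simps)
    qed
  qed
qed

lemma jump_measure_departures:
  assumes \<omega>: "\<omega> \<in> trajs X" and Z: "Z \<in> sets X"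
  shows "emeasure (jump_measure X \<omega>) (Pair \<omega> -` left_limit_in X t Z \<times> space X) =
    (\<Sum>n. if jump_time (Suc n) \<omega> \<le> ereal t \<and> post_state n \<omega> \<in> Some ` Z then 1 else 0)"
proof -
  have C: "Pair \<omega> -` left_limit_in X t Z \<times> space X \<in> sets (Rplus \<Otimes>\<^sub>M X)"
    by (rule pair_measureI[OF section_predictable[OF \<omega> left_limit_in_predictable[OF Z]] sets.top])
  show ?thesis
    unfolding emeasure_jump_measure[OF C]
  proof (intro suminf_cong)
    fix n
    show "(if jump_time (Suc n) \<omega> < \<infinity> then indicator (Pair \<omega> -` left_limit_in X t Z \<times> space X)
        (real_of_ereal (jump_time (Suc n) \<omega>), the (post_state (Suc n) \<omega>)) else 0) =
      (if jump_time (Suc n) \<omega> \<le> ereal t \<and> post_state n \<omega> \<in> Some ` Z then 1 else 0 :: ennreal)"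
    proof (cases "jump_time (Suc n) \<omega> < \<infinity>")
      case True
      obtain r where r: "jump_time (Suc n) \<omega> = ereal r" "0 < r"
        using True jump_time_Suc_pos[OF \<omega>, of n] by (cases "jump_time (Suc n) \<omega>") auto
      obtain z where z: "z \<in> space X" "post_state (Suc n) \<omega> = Some z" using post_state_in_space[OF \<omega> True] .
      have "jump_time n \<omega> \<noteq> \<infinity>"
        using True incseqD[OF incseq_jump_time[OF \<omega>], of n "Suc n"] by auto
      then have "jump_time n \<omega> < ereal r" using jump_time_less_Suc[OF \<omega>, of n] unfolding r(1) by simp
      then have "(\<omega>, r) \<in> left_limit_in X t Z \<longleftrightarrow> r \<le> t \<and> post_state n \<omega> \<in> Some ` Z"
        using left_limit_in_iff[OF \<omega>, of n r t Z] r(1) by (simp del: jump_time.simps)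
      then show ?thesis using r z by (simp add: indicator_def del: jump_time.simps post_state.simps)
    next
      case False
      then have "jump_time (Suc n) \<omega> = \<infinity>" by simp
      then show ?thesis by (simp del: jump_time.simps)
    qed
  qed
qed

context controlled_ctjmdp
begin

lemma along_empty:
  assumes \<omega>: "\<omega> \<in> trajs X" and s: "0 \<le> s"
  shows "along Act \<pi> (\<lambda>z a. q z a ({} - {z})) s \<omega> = 0"
proof (cases "state s \<omega>")
  case (Some z)
  then obtain n where n: "jump_time n \<omega> \<le> ereal s" "post_state n \<omega> = Some z"
    using state_eq_Some_iff[OF \<omega> s] by blast
  have "jump_time n \<omega> < \<infinity>" using n(1) by (rule le_less_trans) simp
  then have "z \<in> space X" using post_state_in_space[OF \<omega>] n(2) by (metis option.inject)
  then have "ennreal (q z a {}) * indicator (Act z) a = 0" for a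
    using q_signed[of z a] by (cases "a \<in> Act z") (auto simp: Gr_iff signed_measure_on_def)
  then have "(\<lambda>b. case b of None \<Rightarrow> 0 | Some a \<Rightarrow> ennreal (q z a ({} - {z})) * indicator (Act z) a) = (\<lambda>b. 0)"
    by (simp add: fun_eq_iff split: option.split)
  then show ?thesis using Some by (simp only: along_def action_avg_def option.case nn_integral_const) simp
qed (simp add: along_def)

lemma rate_measure_arrivals:
  assumes \<omega>: "\<omega> \<in> trajs X" and Z: "Z \<in> sets X"
  shows "emeasure (rate_measure X Act q \<pi> \<omega>) (Pair \<omega> -` (trajs X \<times> {0<..t}) \<times> Z) =
    (\<integral>\<^sup>+ s \<in> {0<..t}. along Act \<pi> (\<lambda>z a. q z a (Z - {z})) s \<omega> \<partial>lborel)"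
proof -
  have C: "Pair \<omega> -` (trajs X \<times> {0<..t}) \<times> Z \<in> sets (Rplus \<Otimes>\<^sub>M X)"
    by (rule pair_measureI[OF section_predictable[OF \<omega> predictable_upto] Z])
  show ?thesis
    unfolding emeasure_rate_measure[OF \<omega> C]
  proof (rule nn_integral_cong)
    fix s :: real
    have "Pair s -` (Pair \<omega> -` (trajs X \<times> {0<..t}) \<times> Z) = (if s \<in> {0<..t} then Z else {})"
      using \<omega> by auto
    then show "along Act \<pi> (\<lambda>z a. q z a (Pair s -` (Pair \<omega> -` (trajs X \<times> {0<..t}) \<times> Z) - {z})) s \<omega> * indicator {0<..} s =
        along Act \<pi> (\<lambda>z a. q z a (Z - {z})) s \<omega> * indicator {0<..t} s"
      using along_empty[OF \<omega>, of s] by (cases "s \<in> {0<..t}") (auto simp: indicator_def)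
  qed
qed

text \<open>Strictly inside a sojourn the left limit of the state is the state itself, which allows replacing
  the predictable set by the indicator of \<open>{\<xi>\<^sub>s \<in> Z}\<close>.\<close>

lemma rate_measure_departures:
  assumes \<omega>: "\<omega> \<in> trajs X" and Z: "Z \<in> sets X"
  shows "emeasure (rate_measure X Act q \<pi> \<omega>) (Pair \<omega> -` left_limit_in X t Z \<times> space X) =
    (\<integral>\<^sup>+ s \<in> {0<..t}. along Act \<pi> (exit_rate X q) s \<omega> * indicator (Some ` Z) (state s \<omega>) \<partial>lborel)"
proof -
  let ?C = "Pair \<omega> -` left_limit_in X t Z \<times> space X"
  have C: "?C \<in> sets (Rplus \<Otimes>\<^sub>M X)"
    by (rule pair_measureI[OF section_predictable[OF \<omega> left_limit_in_predictable[OF Z]] sets.top])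
  have exit: "exit_rate X q = (\<lambda>z a. q z a (space X - {z}))"
    by (simp add: exit_rate_def fun_eq_iff)
  have "AE s in lborel. along Act \<pi> (\<lambda>z a. q z a (Pair s -` ?C - {z})) s \<omega> * indicator {0<..} s =
      along Act \<pi> (exit_rate X q) s \<omega> * indicator (Some ` Z) (state s \<omega>) * indicator {0<..t} s"
    using AE_interval_or_exploded[OF \<omega>]
  proof (rule AE_mp, intro AE_I2 impI)
    fix s :: real
    assume *: "0 < s \<longrightarrow> (\<exists>n. jump_time n \<omega> < ereal s \<and> ereal s < jump_time (Suc n) \<omega>) \<or> explosion_time \<omega> \<le> ereal s"
    have sec: "Pair s -` ?C = (if (\<omega>, s) \<in> left_limit_in X t Z then space X else {})" by auto
    consider "s \<le> 0" | n where "0 < s" "jump_time n \<omega> < ereal s" "ereal s < jump_time (Suc n) \<omega>"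
      | "explosion_time \<omega> \<le> ereal s" using * by fastforce
    then show "along Act \<pi> (\<lambda>z a. q z a (Pair s -` ?C - {z})) s \<omega> * indicator {0<..} s =
        along Act \<pi> (exit_rate X q) s \<omega> * indicator (Some ` Z) (state s \<omega>) * indicator {0<..t} s"
    proof cases
      case 1
      then show ?thesis by (simp add: indicator_def)
    next
      case 2
      have "state s \<omega> = post_state n \<omega>"
        using state_eq_post_state[OF \<omega> less_imp_le[OF 2(2)] 2(3)] .
      then have iff: "(\<omega>, s) \<in> left_limit_in X t Z \<longleftrightarrow> s \<le> t \<and> state s \<omega> \<in> Some ` Z"
        using left_limit_in_iff[OF \<omega> 2(2) less_imp_le[OF 2(3)]] by simp
      show ?thesis
      proof (cases "s \<le> t \<and> state s \<omega> \<in> Some ` Z")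
        case True
        then show ?thesis using 2(1) unfolding sec iff exit by simp
      next
        case False
        then have "along Act \<pi> (\<lambda>z a. q z a (Pair s -` ?C - {z})) s \<omega> = 0"
          using along_empty[OF \<omega>, of s] 2(1) unfolding sec iff if_not_P[OF False] by simp
        then show ?thesis using False by (auto simp: indicator_def)
      qed
    next
      case 3
      then show ?thesis by (simp add: along_def state_exploded)
    qed
  qed
  then show ?thesis
    unfolding emeasure_rate_measure[OF \<omega> C] by (rule nn_integral_cong_AE)
qed

text \<open>Boundedness is a bound on expectations at fixed times; Tonelli's theorem for the measurable version
  of the rates makes \<open>t\<close> times this bound a bound on the expected integral.\<close>

lemma expected_departures_finite:
  assumes P: "prob_space P" "sets P = sets (traj_space X)"
    and Z: "Z \<in> sets X" and bdd: "bounded_set X Act q \<pi> P Z" and t: "0 \<le> t"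
  shows "(\<integral>\<^sup>+ \<omega>. (\<integral>\<^sup>+ s \<in> {0<..t}. along Act \<pi> (exit_rate X q) s \<omega> * indicator (Some ` Z) (state s \<omega>) \<partial>lborel) \<partial>P) < \<infinity>"
proof -
  interpret P: prob_space P by (rule P(1))
  interpret pair_sigma_finite P lborel ..
  have space_P: "space P = trajs X"
    using sets_eq_imp_space_eq[OF P(2)] by (simp add: space_traj_space)
  define C where "C = space (Rplus \<Otimes>\<^sub>M X)"
  have C: "C \<in> sets (Rplus \<Otimes>\<^sub>M X)" unfolding C_def by (rule sets.top)
  have sec: "Pair s -` C = space X" if "0 < s" for s
    using that by (auto simp: C_def space_pair_measure space_Rplus)
  define f where "f s \<omega> = along Act \<pi> (exit_rate X q) s \<omega> * indicator (Some ` Z) (state s \<omega>)" for s \<omega>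
  have f: "f s \<omega> = along Act \<pi> (\<lambda>z a. q z a (Pair s -` C - {z})) s \<omega> * indicator (Some ` Z) (state s \<omega>)"
    if "0 < s" for s \<omega>
  proof -
    have "exit_rate X q = (\<lambda>z a. q z a (space X - {z}))"
      by (simp add: exit_rate_def fun_eq_iff)
    then show ?thesis unfolding f_def sec[OF that] by simp
  qed
  define c where "c = (SUP s \<in> {0<..}. \<integral>\<^sup>+ \<omega>. f s \<omega> \<partial>P)"
  have c: "c < \<infinity>" using bdd unfolding bounded_set_def c_def f_def .
  have [measurable]: "regular_rate Z C \<in> borel_measurable (P \<Otimes>\<^sub>M lborel)"
    using measurable_regular_rate[OF C Z]
      measurable_cong_sets[OF sets_pair_measure_cong[OF P(2) sets_lborel] refl, of borel] by blast
  have "(\<integral>\<^sup>+ \<omega>. (\<integral>\<^sup>+ s \<in> {0<..t}. f s \<omega> \<partial>lborel) \<partial>P) =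
      (\<integral>\<^sup>+ \<omega>. (\<integral>\<^sup>+ s \<in> {0<..t}. regular_rate Z C (\<omega>, s) \<partial>lborel) \<partial>P)"
  proof (rule nn_integral_cong)
    fix \<omega> assume "\<omega> \<in> space P"
    then have \<omega>: "\<omega> \<in> trajs X" by (simp add: space_P)
    have "AE s in lborel. f s \<omega> * indicator {0<..t} s = regular_rate Z C (\<omega>, s) * indicator {0<..t} s"
      using AE_regular_rate[OF \<omega> C, of Z] by (rule AE_mp) (auto intro!: AE_I2 simp: f indicator_def)
    then show "(\<integral>\<^sup>+ s \<in> {0<..t}. f s \<omega> \<partial>lborel) = (\<integral>\<^sup>+ s \<in> {0<..t}. regular_rate Z C (\<omega>, s) \<partial>lborel)"
      by (rule nn_integral_cong_AE)
  qed
  also have "\<dots> = (\<integral>\<^sup>+ s. (\<integral>\<^sup>+ \<omega>. regular_rate Z C (\<omega>, s) * indicator {0<..t} s \<partial>P) \<partial>lborel)"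
    by (rule Fubini'[symmetric]) measurable
  also have "\<dots> \<le> (\<integral>\<^sup>+ s. c * indicator {0<..t} s \<partial>lborel)"
  proof (rule nn_integral_mono)
    fix s :: real
    show "(\<integral>\<^sup>+ \<omega>. regular_rate Z C (\<omega>, s) * indicator {0<..t} s \<partial>P) \<le> c * indicator {0<..t} s"
    proof (cases "s \<in> {0<..t}")
      case True
      then have "(\<integral>\<^sup>+ \<omega>. regular_rate Z C (\<omega>, s) \<partial>P) \<le> (\<integral>\<^sup>+ \<omega>. f s \<omega> \<partial>P)"
        using regular_rate_le_along[OF _ C, of _ Z s] by (intro nn_integral_mono) (simp add: f space_P)
      also have "\<dots> \<le> c" unfolding c_def using True by (intro SUP_upper) simp
      finally show ?thesis using True by simp
    qed simp
  qed
  also have "\<dots> = c * ennreal t"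
    using t by (subst nn_integral_cmult_indicator) simp_all
  also have "\<dots> < \<infinity>" using c by (simp add: ennreal_mult_less_top)
  finally show ?thesis unfolding f_def .
qed

end

section \<open>The forward equation on a bounded set\<close>

lemma ereal_eq_if_ennreal_balance:
  fixes a b c d :: ennreal
  assumes "a + b = c + d" and "c < \<infinity>" and "d < \<infinity>" and "b < \<infinity>"
  shows "enn2ereal d = enn2ereal b + enn2ereal a - enn2ereal c"
proof -
  have fin: "\<bar>enn2ereal u\<bar> \<noteq> \<infinity>" if "u < \<infinity>" for u
    using that enn2ereal_nonneg[of u]
    unfolding infinity_ennreal_def less_ennreal.rep_eq top_ennreal.rep_eq
    by (cases "enn2ereal u") (simp_all add: top_ereal_def)
  have "enn2ereal a + enn2ereal b = enn2ereal c + enn2ereal d"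
    using assms(1) by (metis plus_ennreal.rep_eq)
  moreover have "v = s + r - u"
    if "r + s = u + v" "\<bar>s\<bar> \<noteq> \<infinity>" "\<bar>u\<bar> \<noteq> \<infinity>" "\<bar>v\<bar> \<noteq> \<infinity>" for r s u v :: ereal
    using that by (cases r; cases s; cases u; cases v) simp_all
  ultimately show ?thesis
    using fin[OF assms(2)] fin[OF assms(3)] fin[OF assms(4)] by metis
qed

theorem lemma4:
  fixes X :: "'x measure" and A :: "'a measure"
    and Act :: "'x \<Rightarrow> 'a set" and q :: "'x \<Rightarrow> 'a \<Rightarrow> 'x set \<Rightarrow> real"
    and \<pi> :: "'x traj \<Rightarrow> real \<Rightarrow> 'a option measure"
    and P :: "'x traj measure" and x :: 'x and Z :: "'x set" and t :: real
  assumes "ctjmdp X A Act q"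
    and "\<And>y. y \<in> space X \<Longrightarrow> max_exit_rate X Act q y < \<infinity>"
    and "x \<in> space X"
    and "policy X A Act \<pi>"
    and "is_law X Act q \<pi> x P"
    and "Z \<in> sets X"
    and "bounded_set X Act q \<pi> P Z"
    and "t > 0"
  shows "ereal (state_prob P t (Some ` Z)) =
           ereal (indicator Z x)
           + enn2ereal (\<integral>\<^sup>+ \<omega>. (\<integral>\<^sup>+ s \<in> {0<..t}.
               along Act \<pi> (\<lambda>z a. q z a (Z - {z})) s \<omega> \<partial>lborel) \<partial>P)
           - enn2ereal (\<integral>\<^sup>+ \<omega>. (\<integral>\<^sup>+ s \<in> {0<..t}.
               along Act \<pi> (exit_rate X q) s \<omega> * indicator (Some ` Z) (state s \<omega>) \<partial>lborel) \<partial>P)"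
proof -
  obtain \<kappa> where "\<And>n. \<kappa> n \<in> hist_space X n \<Otimes>\<^sub>M Rplus \<rightarrow>\<^sub>M prob_algebra A"
    and "\<And>\<omega> t n. \<omega> \<in> trajs X \<Longrightarrow> t > 0 \<Longrightarrow> jump_time n \<omega> < ereal t \<Longrightarrow>
      ereal t \<le> jump_time (Suc n) \<omega> \<Longrightarrow> ereal t < explosion_time \<omega> \<Longrightarrow>
      \<pi> \<omega> t = distr (\<kappa> n (hist n \<omega>, t - real_of_ereal (jump_time n \<omega>))) (option_space A) Some"
    using assms(4) unfolding policy_def by blast
  then interpret controlled_ctjmdp X A Act q \<pi> \<kappa> x
    using assms(1,3) by (intro controlled_ctjmdp.intro controlled_ctjmdp_axioms.intro)
  have law: "prob_space P" "sets P = sets (traj_space X)" "AE \<omega> in P. fst \<omega> = x"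
      "is_compensator X P (jump_measure X) (rate_measure X Act q \<pi>)"
    using assms(5) unfolding is_law_def by blast+
  interpret P: prob_space P by (rule law(1))
  note Z = \<open>Z \<in> sets X\<close>
  have t: "0 \<le> t" using assms(8) by simp
  have space_P: "space P = trajs X"
    using sets_eq_imp_space_eq[OF law(2)] by (simp add: space_traj_space)
  have [measurable]: "jump_time n \<in> borel_measurable P" "post_state n \<in> P \<rightarrow>\<^sub>M option_space X"
      "fst \<in> P \<rightarrow>\<^sub>M X" for n
    using measurable_jump_time measurable_post_state measurable_fst_traj
    by (simp_all cong: measurable_cong_sets add: law(2))
  have [measurable]: "Some ` Z \<in> sets (option_space X)" "Z \<in> sets X"
    using Z Some_image_in_sets by auto
  define arrivals departures where
    "arrivals \<omega> = (\<Sum>n. if jump_time (Suc n) \<omega> \<le> ereal t \<and> post_state (Suc n) \<omega> \<in> Some ` Z then 1 else 0 :: ennreal)" and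
    "departures \<omega> = (\<Sum>n. if jump_time (Suc n) \<omega> \<le> ereal t \<and> post_state n \<omega> \<in> Some ` Z then 1 else 0 :: ennreal)"
    for \<omega> :: "'x traj"
  have [measurable]: "arrivals \<in> borel_measurable P" "departures \<in> borel_measurable P"
    unfolding arrivals_def departures_def by measurable
  define arrival_rate departure_rate where
    "arrival_rate = (\<integral>\<^sup>+ \<omega>. (\<integral>\<^sup>+ s \<in> {0<..t}. along Act \<pi> (\<lambda>z a. q z a (Z - {z})) s \<omega> \<partial>lborel) \<partial>P)" and
    "departure_rate = (\<integral>\<^sup>+ \<omega>. (\<integral>\<^sup>+ s \<in> {0<..t}. along Act \<pi> (exit_rate X q) s \<omega> * indicator (Some ` Z) (state s \<omega>) \<partial>lborel) \<partial>P)"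
  have arrival_rate_eq: "(\<integral>\<^sup>+ \<omega>. arrivals \<omega> \<partial>P) = arrival_rate"
  proof -
    have "(\<integral>\<^sup>+ \<omega>. arrivals \<omega> \<partial>P) =
        (\<integral>\<^sup>+ \<omega>. emeasure (jump_measure X \<omega>) (Pair \<omega> -` (trajs X \<times> {0<..t}) \<times> Z) \<partial>P)"
      unfolding arrivals_def by (intro nn_integral_cong jump_measure_arrivals[symmetric] Z) (simp add: space_P)
    also have "\<dots> = (\<integral>\<^sup>+ \<omega>. emeasure (rate_measure X Act q \<pi> \<omega>) (Pair \<omega> -` (trajs X \<times> {0<..t}) \<times> Z) \<partial>P)"
      by (intro compensator_rectangle[OF law(4) space_P] predictable_upto Z) simp_all
    also have "\<dots> = arrival_rate"
      unfolding arrival_rate_def by (intro nn_integral_cong rate_measure_arrivals Z) (simp add: space_P)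
    finally show ?thesis .
  qed
  have departure_rate_eq: "(\<integral>\<^sup>+ \<omega>. departures \<omega> \<partial>P) = departure_rate"
  proof -
    have "(\<integral>\<^sup>+ \<omega>. departures \<omega> \<partial>P) =
        (\<integral>\<^sup>+ \<omega>. emeasure (jump_measure X \<omega>) (Pair \<omega> -` left_limit_in X t Z \<times> space X) \<partial>P)"
      unfolding departures_def by (intro nn_integral_cong jump_measure_departures[symmetric] Z) (simp add: space_P)
    also have "\<dots> = (\<integral>\<^sup>+ \<omega>. emeasure (rate_measure X Act q \<pi> \<omega>) (Pair \<omega> -` left_limit_in X t Z \<times> space X) \<partial>P)"
      by (intro compensator_rectangle[OF law(4) space_P] left_limit_in_predictable Z sets.top) simp_all
    also have "\<dots> = departure_rate"
      unfolding departure_rate_def by (intro nn_integral_cong rate_measure_departures Z) (simp add: space_P)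
    finally show ?thesis .
  qed
  define S where "S = {\<omega> \<in> space P. state t \<omega> \<in> Some ` Z}"
  have S: "S \<in> sets P"
  proof -
    have "S = {\<omega> \<in> space P. \<exists>n. jump_time n \<omega> \<le> ereal t \<and> ereal t < jump_time (Suc n) \<omega> \<and> post_state n \<omega> \<in> Some ` Z}"
      unfolding S_def using state_eq_Some_iff[OF _ t] by (fastforce simp: space_P)
    also have "\<dots> \<in> sets P" by measurable
    finally show ?thesis .
  qed
  have "arrivals \<omega> + indicator Z (fst \<omega>) = departures \<omega> + indicator S \<omega>" if "\<omega> \<in> space P" for \<omega>
    using arrivals_departures_balance[of \<omega> X t Z] that t unfolding arrivals_def departures_def S_def
    by (simp add: space_P indicator_def)
  then have "(\<integral>\<^sup>+ \<omega>. arrivals \<omega> + indicator Z (fst \<omega>) \<partial>P) = (\<integral>\<^sup>+ \<omega>. departures \<omega> + indicator S \<omega> \<partial>P)"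
    by (rule nn_integral_cong)
  moreover have "(\<integral>\<^sup>+ \<omega>. indicator Z (fst \<omega>) \<partial>P) = (\<integral>\<^sup>+ \<omega>. indicator Z x \<partial>P)"
    by (rule nn_integral_cong_AE) (use law(3) in auto)
  ultimately have balance: "arrival_rate + indicator Z x = departure_rate + emeasure P S"
    using S by (simp add: nn_integral_add arrival_rate_eq departure_rate_eq P.emeasure_space_1)
  have "departure_rate < \<infinity>"
    unfolding departure_rate_def by (rule expected_departures_finite[OF law(1,2) Z assms(7) t])
  then have "enn2ereal (emeasure P S) = enn2ereal (indicator Z x) + enn2ereal arrival_rate - enn2ereal departure_rate"
    by (intro ereal_eq_if_ennreal_balance[OF balance]) (simp_all add: indicator_def P.emeasure_eq_measure)
  moreover have "enn2ereal (emeasure P S) = ereal (state_prob P t (Some ` Z))"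
    by (simp add: state_prob_def S_def P.emeasure_eq_measure enn2ereal_ennreal)
  moreover have "enn2ereal (indicator Z x) = ereal (indicator Z x)"
    by (simp add: indicator_def one_ennreal.rep_eq zero_ennreal.rep_eq one_ereal_def zero_ereal_def)
  ultimately show ?thesis unfolding arrival_rate_def departure_rate_def by simp
qed

end
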